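(* Let $X_1,X_2,\dots$ be independent identically distributed real random variables and put $S_n=X_1+\dots+X_n$. Let $\{\tau_n\}_{n=1}^\infty$ be any sequence of nonnegative real numbers, and let $\{a_n\}_{n=1}^\infty$ be a nondecreasing sequence of strictly positive real numbers tending to $\infty$. Assume there exist finite constants $\theta\ge 1$, $C>0$ and $N\ge 2$ such that for all $n\ge N$ $$\frac{a_n^{3\theta}}{n^{\theta-1}}\sum_{k=n}^\infty \frac{k^\theta\tau_k}{a_k^{3\theta}}\le C\sum_{k=1}^{n-1}k\tau_k .$$ If $\theta>1$, assume additionally that $$\liminf_{n\to\infty}\ \inf_{k\ge n}\ \frac{a_k^3}{k\,a_n^3}\sum_{j=1}^{n-1}j\tau_j>0 .$$ Consider the following three conditions: (i) there is a sequence $\{\mu_n\}_{n=1}^\infty$, with $\mu_n$ a median of $S_n$ for every $n$, such that for all $\varepsilon>0$ we have $\sum_{n\in M(\varepsilon)}\tau_n<\infty$, where $M(\varepsilon)=\{n\in\mathbb Z^+: |\mu_n|>\varepsilon a_n\}$; (ii) $\sum_{n=1}^\infty n\tau_n P(|X_1|\ge \varepsilon a_n)<\infty$ for all $\varepsilon>0$; (iii) $\sum_{n=1}^\infty \tau_n e^{-\varepsilon^2a_n^2/(nT_{\varepsilon,n})}<\infty$ for all $\varepsilon>0$, where $T_{\varepsilon,n}=E[X_1^2\cdot 1_{\{|X_1|<\varepsilon a_n\}}]$ and where $e^{-t/0}=0$ for all $t>0$. If (i), (ii) and (iii) all hold, then $$\sum_{n=1}^\infty \tau_nP(|S_n|\ge\varepsilon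 a_n)<\infty\quad\text{for all }\varepsilon>0. \qquad ( * )$$ Conversely, if the sequence $\{\tau_n\}$ satisfies Condition A and $( * )$ holds, then (i), (ii) and (iii) all hold.
   Context: Condition A: a nonnegative sequence $\{\tau_n\}_{n=1}^\infty$ satisfies Condition A if for every nonnegative nonincreasing real sequence $\{c_n\}_{n=1}^\infty$ such that $\sum_{n=1}^\infty\tau_n\min(nc_n,1)<\infty$ one also has $\sum_{n=1}^\infty \tau_n nc_n<\infty$. *)

theory Defs
  imports "HOL-Probability.Probability"
begin

text \<open>
  Sequences indexed by the positive integers are functions on \<^typ>\<open>nat\<close> of which only the values on
  \<open>{1..}\<close> matter. The terms of all infinite series below are nonnegative, so that
  convergence (\<open>< \<infinity>\<close>) is unconditional summability on \<open>{1..}\<close>.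
\<close>

definition condition_A :: "(nat \<Rightarrow> real) \<Rightarrow> bool" where
  "condition_A \<tau> \<longleftrightarrow>
     (\<forall>n\<ge>1. 0 \<le> \<tau> n) \<and>
     (\<forall>c :: nat \<Rightarrow> real.
        (\<forall>n\<ge>1. 0 \<le> c n) \<longrightarrow> antimono_on {1..} c \<longrightarrow>
        (\<lambda>n. \<tau> n * min (real n * c n) 1) summable_on {1..} \<longrightarrow>
        (\<lambda>n. \<tau> n * (real n * c n)) summable_on {1..})"

definition is_median :: "'a measure \<Rightarrow> ('a \<Rightarrow> real) \<Rightarrow> real \<Rightarrow> bool" where
  "is_median M Y m \<longleftrightarrow>
     \<P>(\<omega> in M. Y \<omega> \<le> m) \<ge> 1 / 2 \<and> \<P>(\<omega> in M. Y \<omega> \<ge> m) \<ge> 1 / 2"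

definition partial_sum :: "(nat \<Rightarrow> 'a \<Rightarrow> real) \<Rightarrow> nat \<Rightarrow> 'a \<Rightarrow> real" where
  "partial_sum X n \<omega> = (\<Sum>i=1..n. X i \<omega>)"

definition iid_sequence :: "'a measure \<Rightarrow> (nat \<Rightarrow> 'a \<Rightarrow> real) \<Rightarrow> bool" where
  "iid_sequence M X \<longleftrightarrow>
     prob_space.indep_vars M (\<lambda>_. borel) X {1..} \<and>
     (\<forall>i\<ge>1. distr M borel (X i) = distr M borel (X 1))"

definition median_condition ::
    "'a measure \<Rightarrow> (nat \<Rightarrow> 'a \<Rightarrow> real) \<Rightarrow> (nat \<Rightarrow> real) \<Rightarrow> (nat \<Rightarrow> real) \<Rightarrow> bool" where
  "median_condition M X \<tau> a \<longleftrightarrow>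
     (\<exists>\<mu> :: nat \<Rightarrow> real.
        (\<forall>n\<ge>1. is_median M (partial_sum X n) (\<mu> n)) \<and>
        (\<forall>\<epsilon>>0. \<tau> summable_on {n. n \<ge> 1 \<and> \<bar>\<mu> n\<bar> > \<epsilon> * a n}))"

definition tail_condition ::
    "'a measure \<Rightarrow> (nat \<Rightarrow> 'a \<Rightarrow> real) \<Rightarrow> (nat \<Rightarrow> real) \<Rightarrow> (nat \<Rightarrow> real) \<Rightarrow> bool" where
  "tail_condition M X \<tau> a \<longleftrightarrow>
     (\<forall>\<epsilon>>0. (\<lambda>n. real n * \<tau> n * \<P>(\<omega> in M. \<bar>X 1 \<omega>\<bar> \<ge> \<epsilon> * a n)) summable_on {1..})"

definition trunc_second_moment :: "'a measure \<Rightarrow> ('a \<Rightarrow> real) \<Rightarrow> real \<Rightarrow> real" where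
  "trunc_second_moment M Y r =
     (LINT \<omega>|M. (Y \<omega>)\<^sup>2 * indicator {\<omega>. \<bar>Y \<omega>\<bar> < r} \<omega>)"

text \<open>
  The quantity \<open>e\<^bsup>-t/s\<^esup>\<close> with the convention \<open>e\<^bsup>-t/0\<^esup> = 0\<close>;
  in HOL \<open>t / 0 = 0\<close> would give \<open>1\<close> instead.
\<close>

definition exp_neg_quot :: "real \<Rightarrow> real \<Rightarrow> real" where
  "exp_neg_quot t s = (if s = 0 then 0 else exp (- t / s))"

definition exponential_condition ::
    "'a measure \<Rightarrow> (nat \<Rightarrow> 'a \<Rightarrow> real) \<Rightarrow> (nat \<Rightarrow> real) \<Rightarrow> (nat \<Rightarrow> real) \<Rightarrow> bool" where
  "exponential_condition M X \<tau> a \<longleftrightarrow>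
     (\<forall>\<epsilon>>0. (\<lambda>n. \<tau> n * exp_neg_quot (\<epsilon>\<^sup>2 * (a n)\<^sup>2)
                        (real n * trunc_second_moment M (X 1) (\<epsilon> * a n))) summable_on {1..})"

definition large_deviation_series_converges ::
    "'a measure \<Rightarrow> (nat \<Rightarrow> 'a \<Rightarrow> real) \<Rightarrow> (nat \<Rightarrow> real) \<Rightarrow> (nat \<Rightarrow> real) \<Rightarrow> bool" where
  "large_deviation_series_converges M X \<tau> a \<longleftrightarrow>
     (\<forall>\<epsilon>>0. (\<lambda>n. \<tau> n * \<P>(\<omega> in M. \<bar>partial_sum X n \<omega>\<bar> \<ge> \<epsilon> * a n)) summable_on {1..})"

end

theory Submission
  imports Defs
begin

text \<open>
  Truncate \<open>X\<^sub>i\<close> at level \<open>L = \<delta> a\<^sub>n\<close>; let \<open>T\<close> and \<open>\<beta>\<close> be the second and third absolute moments of a truncated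
  variable, \<open>v = n T / a\<^sub>n\<^sup>2\<close> and \<open>u = n \<beta> / a\<^sub>n\<^sup>3\<close>. Summation by parts turns the tail condition and the
  regularity of \<open>\<tau>\<close> and \<open>a\<close> into convergence of \<open>\<Sum> \<tau>\<^sub>n u\<^sup>\<theta>\<close>.

  For sufficiency, a Chernoff bound of Fuk--Nagaev type estimates the deviation of the truncated sum from
  its mean by \<open>exp (- c / v)\<close> plus a multiple of \<open>u\<^sup>\<theta>\<close>; the mean is then located by means of the medians.

  For necessity, a second moment argument bounds \<open>min (n P(\<bar>X\<^sub>1\<bar> \<ge> 3 b)) 1\<close> by a multiple of
  \<open>P(\<bar>S\<^sub>n\<bar> \<ge> b)\<close>, which together with Condition A gives the tail condition. The Gaussian lower bound comes
  from splitting the sum into about \<open>\<epsilon>\<^sup>2 / (4 v)\<close> blocks, each of which exceeds a tenth of its standard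
  deviation with probability at least \<open>1 / 22\<close>. Whenever this argument fails, \<open>u\<close> is at least a constant times
  \<open>(min v 1)\<^sup>3\<close>, so that \<open>exp (- \<epsilon>\<^sup>2 / v)\<close> is bounded by a multiple of \<open>u\<^sup>\<theta>\<close>.
\<close>

section \<open>Elementary inequalities\<close>

text \<open>What the regularity hypothesis delivers is convergence of the series of
  \<open>\<tau> n * u powr \<theta>\<close>, so every error term has to come out at order
  \<open>u powr \<theta>\<close> and not merely \<open>u\<close>. In the upper bound this forces the
  truncation level down to \<open>\<epsilon> / (4 * \<theta>)\<close> times \<open>a n\<close>. In
  the lower bound it is harmless, since up to a constant the Gaussian term lies below every power of
  \<open>min 1 v\<close>, hence below \<open>(min 1 v ^ 3) powr \<theta>\<close>. For
  \<open>\<theta> > 1\<close> summation by parts leaves a factor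
  \<open>u powr (\<theta> - 1)\<close>; the liminf hypothesis bounds it uniformly. The truncated
  mean is never estimated directly. In the upper bound concentration puts it close to the median,
  which condition (i) controls; in the lower bound a mean carrying half of the second moment makes
  the sum large by itself. A probability cannot exceed 1, so a lower bound by tails reaches only
  \<open>min (n * tail) 1\<close>; Condition A removes the minimum. Lost factors such as
  \<open>1 / 3\<close> and \<open>1 / 40\<close> in deviation levels cost nothing, because every
  condition is asked for all positive \<epsilon>.\<close>

lemma exp_le_cubic:
  fixes x :: real
  shows "exp x \<le> 1 + x + x\<^sup>2 / 2 + \<bar>x\<bar> ^ 3 * exp \<bar>x\<bar> / 6"
proof -
  obtain t where t: "\<bar>t\<bar> \<le> \<bar>x\<bar>" "exp x = (\<Sum>m<3. x ^ m / fact m) + exp t / fact 3 * x ^ 3"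
    using Maclaurin_exp_le[of x 3] by blast
  have "exp t * x ^ 3 \<le> exp \<bar>x\<bar> * \<bar>x\<bar> ^ 3"
  proof -
    have "exp t * x ^ 3 \<le> exp t * \<bar>x\<bar> ^ 3"
      by (intro mult_left_mono) (auto simp: power_abs[symmetric])
    also have "\<dots> \<le> exp \<bar>x\<bar> * \<bar>x\<bar> ^ 3"
      using t(1) by (intro mult_right_mono) auto
    finally show ?thesis .
  qed
  then show ?thesis
    using t(2) by (simp add: eval_nat_numeral field_simps)
qed

lemma powr_le_exp:
  fixes y p :: real
  assumes "y \<ge> 0" "p > 0"
  shows "y powr p \<le> p powr p * exp y"
proof -
  have "y / p \<le> exp (y / p)"
    using exp_ge_add_one_self[of "y / p"] by linarith
  then have "(y / p) powr p \<le> exp (y / p) powr p"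
    using assms by (intro powr_mono2) auto
  also have "\<dots> = exp y"
    using assms by (simp add: exp_powr_real)
  finally show ?thesis
    using assms by (simp add: powr_divide field_simps)
qed

text \<open>Applied with \<open>p = 3 * \<theta>\<close>: a bound of \<open>min 1 v ^ 3\<close> by a
  multiple of \<open>u\<close> then turns the Gaussian term into a multiple of
  \<open>u powr \<theta>\<close>.\<close>

lemma exp_neg_le_min_powr:
  fixes e p :: real
  assumes "e > 0" "p > 0"
  obtains K where "K > 0" "\<And>v. v > 0 \<Longrightarrow> exp (- (e / v)) \<le> K * min 1 v powr p"
proof
  let ?K = "1 + (p / e) powr p"
  show "?K > 0" by (smt (verit) powr_ge_zero)
  fix v :: real assume v: "v > 0"
  show "exp (- (e / v)) \<le> ?K * min 1 v powr p"
  proof (cases "v \<ge> 1")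
    case True
    have "exp (- (e / v)) \<le> 1" using v assms by simp
    also have "1 \<le> ?K" by simp
    finally show ?thesis using True by simp
  next
    case False
    have "(e / v) powr p \<le> p powr p * exp (e / v)"
      using v assms by (intro powr_le_exp) auto
    then have "exp (- (e / v)) \<le> p powr p / (e / v) powr p"
      using v assms by (simp add: exp_minus field_simps)
    also have "\<dots> = (p / e) powr p * v powr p"
      using v assms by (simp add: powr_divide)
    also have "\<dots> \<le> ?K * v powr p"
      by (intro mult_right_mono) auto
    finally show ?thesis using False by simp
  qed
qed

lemma cube_exp_half_le:
  fixes y :: real
  assumes "y \<ge> 0"
  shows "y ^ 3 * exp (- y / 2) \<le> 216"
proof -
  have "(y / 2) powr 3 \<le> 3 powr 3 * exp (y / 2)"
    using assms by (intro powr_le_exp) auto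
  then have "(y / 2) ^ 3 \<le> 27 * exp (y / 2)"
    using assms by (simp add: powr_numeral)
  then show ?thesis
    by (simp add: exp_minus field_simps power_divide)
qed

text \<open>Expand \<open>(y - s)\<^sup>2 * (2 * y + s) \<ge> 0\<close>. As a function of
  \<open>y\<^sup>2\<close>, the left side is the tangent of \<open>2 * y ^ 3\<close> at
  \<open>y = s\<close>, so integrating it yields Lyapunov's inequality between second and third
  moments.\<close>

lemma three_mult_le_cube:
  fixes s y :: real
  assumes "s \<ge> 0" "y \<ge> 0"
  shows "3 * s * y\<^sup>2 - s ^ 3 \<le> 2 * y ^ 3"
proof -
  have "0 \<le> (y - s)\<^sup>2 * (2 * y + s)" using assms by auto
  then show ?thesis by (simp add: power2_eq_square power3_eq_cube algebra_simps)
qed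

section \<open>Summability of nonnegative sequences on the positive integers\<close>

text \<open>Domination is asked for only from \<open>n0\<close> on, because the probabilistic lower
  bounds need \<open>n \<ge> 8\<close> or a threshold beyond a fixed quantile; the earlier terms
  form a finite sum.\<close>

lemma summable_on_atLeast1_comparison:
  fixes f g :: "nat \<Rightarrow> real"
  assumes f: "f summable_on {1..}"
    and le: "\<And>n. n \<ge> n0 \<Longrightarrow> n \<ge> 1 \<Longrightarrow> g n \<le> f n" and nn: "\<And>n. n \<ge> 1 \<Longrightarrow> 0 \<le> g n"
  shows "g summable_on {1..}"
proof -
  have "f summable_on {max n0 1..}"
    by (rule summable_on_subset[OF f]) auto
  then have "g summable_on {max n0 1..}"
    by (rule summable_on_comparison_test) (auto intro: le nn)
  moreover have "g summable_on {1..<max n0 1}"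
    by simp
  ultimately have "g summable_on ({1..<max n0 1} \<union> {max n0 1..})"
    by (intro summable_on_union)
  moreover have "{1..<max n0 1} \<union> {max n0 1..} = {1..}"
    by auto
  ultimately show ?thesis by simp
qed

lemma summable_on_atLeastI_bounded:
  fixes f :: "nat \<Rightarrow> real"
  assumes nn: "\<And>n. n \<ge> m \<Longrightarrow> 0 \<le> f n" and bd: "\<And>K. (\<Sum>n=m..K. f n) \<le> B"
  shows "f summable_on {m..}"
proof (rule nonneg_bdd_above_summable_on)
  show "bdd_above (sum f ` {F. F \<subseteq> {m..} \<and> finite F})"
  proof (rule bdd_aboveI2)
    fix F assume "F \<in> {F. F \<subseteq> {m..} \<and> finite F}"
    then have F: "F \<subseteq> {m..}" "finite F" by auto
    then have "F \<subseteq> {m..Max F}" by auto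
    then have "sum f F \<le> (\<Sum>n=m..Max F. f n)"
      by (intro sum_mono2) (auto intro: nn)
    with bd show "sum f F \<le> B" by (meson order_trans)
  qed
qed (use nn in auto)

text \<open>Mean value theorem, playing the part of the chain rule for
  \<open>B powr \<theta>\<close> in a sum by parts. The case \<open>x = 0\<close> is separate, since
  differentiating \<open>powr\<close> requires a positive base.\<close>

lemma powr_diff_le:
  fixes x y \<theta> :: real
  assumes "0 \<le> x" "x \<le> y" "\<theta> \<ge> 1"
  shows "y powr \<theta> - x powr \<theta> \<le> \<theta> * y powr (\<theta> - 1) * (y - x)"
proof (cases "x < y \<and> x > 0")
  case True
  have "\<exists>z. x < z \<and> z < y \<and> y powr \<theta> - x powr \<theta> = (y - x) * (\<theta> * z powr (\<theta> - 1))"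
    using True assms by (intro MVT2) (auto intro!: derivative_eq_intros simp: powr_diff field_simps)
  then obtain z where z: "x < z" "z < y" "y powr \<theta> - x powr \<theta> = (y - x) * (\<theta> * z powr (\<theta> - 1))"
    by blast
  have "z powr (\<theta> - 1) \<le> y powr (\<theta> - 1)"
    using z assms by (intro powr_mono2) auto
  then have "(y - x) * (\<theta> * z powr (\<theta> - 1)) \<le> (y - x) * (\<theta> * y powr (\<theta> - 1))"
    using assms by (intro mult_left_mono) auto
  then show ?thesis unfolding z(3) by (simp add: algebra_simps)
next
  case False
  then consider "x = y" | "x = 0" "y > 0" using assms by fastforce
  then show ?thesis
  proof cases
    case 2
    then have "y powr \<theta> = y powr (\<theta> - 1) * y"
      by (simp add: powr_diff)
    with 2 assms show ?thesis by (simp add: mult_right_mono)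
  qed auto
qed

section \<open>A weighted Hardy inequality\<close>

lemma abel_sum_tail:
  fixes F w :: "nat \<Rightarrow> real"
  assumes "L \<le> K"
  shows "(\<Sum>k=L..<K. (F (Suc k) - F k) * (\<Sum>j=1..k. w j)) + (1 - F K) * (\<Sum>j=1..K. w j)
       = (1 - F L) * (\<Sum>j=1..L. w j) + (\<Sum>k=L..<K. w (Suc k) * (1 - F (Suc k)))"
  using assms by (induction K rule: dec_induct) (auto simp: algebra_simps)

lemma abel_sum_tail_bound:
  fixes F w :: "nat \<Rightarrow> real"
  assumes w: "\<And>n. n \<ge> 1 \<Longrightarrow> 0 \<le> w n" and F1: "\<And>n. F n \<le> 1"
    and summ: "(\<lambda>n. w n * (1 - F n)) summable_on {1..}"
    and LK: "L \<le> K"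
  shows "(\<Sum>k=L..<K. (F (Suc k) - F k) * (\<Sum>j=1..k. w j))
       \<le> (1 - F L) * (\<Sum>j=1..L. w j) + infsum (\<lambda>n. w n * (1 - F n)) {1..}"
proof -
  have "(1 - F K) * (\<Sum>j=1..K. w j) \<ge> 0"
    using w F1[of K] by (intro mult_nonneg_nonneg sum_nonneg) auto
  moreover have "(\<Sum>k=L..<K. w (Suc k) * (1 - F (Suc k))) = (\<Sum>k=Suc L..K. w k * (1 - F k))"
    using sum.shift_bounds_Suc_ivl[of "\<lambda>k. w k * (1 - F k)" L K]
    by (simp add: atLeastLessThanSuc_atLeastAtMost)
  moreover have "(\<Sum>k=Suc L..K. w k * (1 - F k)) \<le> infsum (\<lambda>n. w n * (1 - F n)) {1..}"
    by (rule finite_sum_le_infsum[OF summ]) (use w F1 in \<open>auto intro!: mult_nonneg_nonneg\<close>)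
  ultimately show ?thesis
    using abel_sum_tail[OF LK, of F w] by linarith
qed

lemma abel_sum_powr:
  fixes G R :: "nat \<Rightarrow> real"
  assumes "L \<le> K"
  shows "(\<Sum>k=L..K. (R k - R (Suc k)) * G k) + R (Suc K) * G K
       = R L * G L + (\<Sum>k=L..<K. R (Suc k) * (G (Suc k) - G k))"
  using assms by (induction K rule: dec_induct) (auto simp: algebra_simps)

text \<open>Telescoping writes \<open>B K\<close> through terms
  \<open>a (Suc k) ^ 3 * (F (Suc k) - F k)\<close>. By \<open>growth\<close>,
  \<open>K * a (Suc k) ^ 3\<close> can be exchanged for \<open>a K ^ 3 * W (Suc k) / c\<close>, with
  the same \<open>a K ^ 3\<close> for all \<open>k\<close>; what remains is the sum bounded by
  \<open>V\<close>. This is the uniform bound on \<open>u\<close>.\<close>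

lemma increment_ratio_bounded:
  fixes a B F W :: "nat \<Rightarrow> real"
  assumes a: "\<And>n. n \<ge> 1 \<Longrightarrow> a n > 0"
    and growth: "\<And>j k. n0 \<le> j \<Longrightarrow> j \<le> k \<Longrightarrow> c * (real k * a j ^ 3) \<le> a k ^ 3 * W j"
    and c: "c > 0" and n0: "n0 \<ge> 1" and D: "D \<ge> 0" and B0: "\<And>n. 0 \<le> B n"
    and F: "mono F"
    and incr: "\<And>n. n \<ge> 1 \<Longrightarrow> B (Suc n) - B n \<le> D * a (Suc n) ^ 3 * (F (Suc n) - F n)"
    and V: "\<And>K. n0 \<le> K \<Longrightarrow> (\<Sum>k=n0..<K. (F (Suc k) - F k) * W (Suc k)) \<le> V"
    and K: "n0 \<le> K"
  shows "real K * B K / a K ^ 3 \<le> (W n0 / a n0 ^ 3 * B n0 + D * V) / c"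
proof -
  have aK: "a K > 0" "a n0 > 0" using a K n0 by auto
  have "B K = B n0 + (\<Sum>k=n0..<K. B (Suc k) - B k)"
    using K by (simp add: sum_Suc_diff')
  also have "\<dots> \<le> B n0 + (\<Sum>k=n0..<K. D * a (Suc k) ^ 3 * (F (Suc k) - F k))"
    using n0 by (intro add_left_mono sum_mono incr) auto
  finally have "B K \<le> B n0 + (\<Sum>k=n0..<K. D * a (Suc k) ^ 3 * (F (Suc k) - F k))" .
  then have "real K * B K \<le> real K * (B n0 + (\<Sum>k=n0..<K. D * a (Suc k) ^ 3 * (F (Suc k) - F k)))"
    by (rule mult_left_mono) simp
  then have "c * (real K * B K)
      \<le> c * (real K * (B n0 + (\<Sum>k=n0..<K. D * a (Suc k) ^ 3 * (F (Suc k) - F k))))"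
    by (rule mult_left_mono[OF _ less_imp_le[OF c]])
  also have "\<dots> = c * real K * B n0
      + (\<Sum>k=n0..<K. D * (F (Suc k) - F k) * (c * (real K * a (Suc k) ^ 3)))"
    by (simp add: sum_distrib_left algebra_simps)
  also have "\<dots> \<le> a K ^ 3 * (W n0 / a n0 ^ 3 * B n0)
      + (\<Sum>k=n0..<K. D * (F (Suc k) - F k) * (a K ^ 3 * W (Suc k)))"
  proof (intro add_mono sum_mono mult_left_mono)
    have "c * real K \<le> a K ^ 3 * (W n0 / a n0 ^ 3)"
      using growth[of n0 K] K aK by (simp add: field_simps)
    then have "c * real K * B n0 \<le> a K ^ 3 * (W n0 / a n0 ^ 3) * B n0"
      using B0 by (intro mult_right_mono) auto
    then show "c * real K * B n0 \<le> a K ^ 3 * (W n0 / a n0 ^ 3 * B n0)"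
      by (simp add: mult.assoc)
  next
    fix k assume "k \<in> {n0..<K}"
    then show "c * (real K * a (Suc k) ^ 3) \<le> a K ^ 3 * W (Suc k)"
      using growth by auto
    show "0 \<le> D * (F (Suc k) - F k)"
      using D F by (auto intro!: mult_nonneg_nonneg simp: mono_def)
  qed
  also have "\<dots> = a K ^ 3 * (W n0 / a n0 ^ 3 * B n0
      + D * (\<Sum>k=n0..<K. (F (Suc k) - F k) * W (Suc k)))"
    by (simp add: sum_distrib_left algebra_simps)
  also have "\<dots> \<le> a K ^ 3 * (W n0 / a n0 ^ 3 * B n0 + D * V)"
    using D aK V[OF K] by (intro mult_left_mono add_left_mono) auto
  finally show ?thesis
    using aK c by (simp add: field_simps)
qed

text \<open>Hardy-type argument: \<open>t\<close> is summed by parts against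
  \<open>B powr \<theta>\<close>. The regularity hypothesis enters as a bound on the tail series
  \<open>R\<close>, and the outcome is a multiple of the sum of
  \<open>(F (Suc k) - F k) * W (Suc k)\<close>, finite by \<open>tails\<close>.\<close>

lemma powr_third_moment_summable:
  fixes \<tau> a B F :: "nat \<Rightarrow> real" and \<theta> C c D :: real and N :: nat
  defines "W \<equiv> (\<lambda>n. \<Sum>j=1..n-1. real j * \<tau> j)"
  assumes \<tau>: "\<And>n. n \<ge> 1 \<Longrightarrow> \<tau> n \<ge> 0" and a: "\<And>n. n \<ge> 1 \<Longrightarrow> a n > 0"
    and \<theta>: "\<theta> \<ge> 1" and C: "C > 0"
    and summ: "\<And>n. n \<ge> N \<Longrightarrow> (\<lambda>k. real k powr \<theta> * \<tau> k / a k powr (3 * \<theta>)) summable_on {n..}"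
    and tail: "\<And>n. n \<ge> N \<Longrightarrow> a n powr (3 * \<theta>) / real n powr (\<theta> - 1) *
             (\<Sum>\<^sub>\<infinity>k\<in>{n..}. real k powr \<theta> * \<tau> k / a k powr (3 * \<theta>)) \<le> C * W n"
    and growth: "\<theta> > 1 \<Longrightarrow> \<exists>c>0. \<exists>n0. \<forall>j\<ge>n0. \<forall>k\<ge>j. c * (real k * a j ^ 3) \<le> a k ^ 3 * W j"
    and D: "D \<ge> 0" and B0: "\<And>n. 0 \<le> B n" and B: "mono B"
    and F: "mono F" and F1: "\<And>n. F n \<le> 1"
    and incr: "\<And>n. n \<ge> 1 \<Longrightarrow> B (Suc n) - B n \<le> D * a (Suc n) ^ 3 * (F (Suc n) - F n)"
    and tails: "(\<lambda>n. real n * \<tau> n * (1 - F n)) summable_on {1..}"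
  shows "(\<lambda>n. \<tau> n * (real n * B n / a n ^ 3) powr \<theta>) summable_on {1..}"
proof -
  define t where "t = (\<lambda>k. real k powr \<theta> * \<tau> k / a k powr (3 * \<theta>))"
  define R where "R = (\<lambda>n. infsum t {n..})"
  have W_nonneg: "W n \<ge> 0" for n
    unfolding W_def using \<tau> by (intro sum_nonneg mult_nonneg_nonneg) auto
  have V: "(\<Sum>k=L..<K. (F (Suc k) - F k) * W (Suc k))
      \<le> (1 - F L) * W (Suc L) + infsum (\<lambda>n. real n * \<tau> n * (1 - F n)) {1..}" if "L \<le> K" for L K
    unfolding W_def diff_Suc_1
    by (rule abel_sum_tail_bound[OF _ F1 tails that]) (use \<tau> in auto)
  \<comment> \<open>For \<open>\<theta> = 1\<close> the exponent is 0 and the power is at most 1;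
    for \<open>\<theta> > 1\<close> the bound comes from
    \<open>increment_ratio_bounded\<close>.\<close>
  have "\<exists>L H. N \<le> L \<and> 1 \<le> L \<and> H \<ge> 0 \<and>
      (\<forall>K\<ge>L. (real K * B K / a K ^ 3) powr (\<theta> - 1) \<le> H)"
  proof (cases "\<theta> > 1")
    case False
    then have "\<theta> = 1" using \<theta> by simp
    then show ?thesis
      by (intro exI[of _ "max N 1"] exI[of _ 1]) auto
  next
    case True
    then obtain c n1 where c: "c > 0"
      "\<And>j k. n1 \<le> j \<Longrightarrow> j \<le> k \<Longrightarrow> c * (real k * a j ^ 3) \<le> a k ^ 3 * W j"
      using growth by blast
    define n0 where "n0 = max (max N 1) n1"
    let ?H = "(W n0 / a n0 ^ 3 * B n0
       + D * ((1 - F n0) * W (Suc n0) + infsum (\<lambda>n. real n * \<tau> n * (1 - F n)) {1..})) / c"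
    have "real K * B K / a K ^ 3 \<le> ?H" if "K \<ge> n0" for K
      by (rule increment_ratio_bounded[OF a c(2) c(1) _ D B0 F incr V])
         (use that in \<open>auto simp: n0_def\<close>)
    moreover have "0 \<le> real K * B K / a K ^ 3" if "K \<ge> n0" for K
      using B0 a[of K] that by (auto simp: n0_def intro!: divide_nonneg_pos mult_nonneg_nonneg)
    ultimately have "\<forall>K\<ge>n0. (real K * B K / a K ^ 3) powr (\<theta> - 1) \<le> ?H powr (\<theta> - 1)"
      using \<theta> by (auto intro!: powr_mono2)
    then show ?thesis
      by (intro exI[of _ n0] exI[of _ "?H powr (\<theta> - 1)"]) (auto simp: n0_def)
  qed
  then obtain L H where L: "N \<le> L" "1 \<le> L" and H: "H \<ge> 0"
    "\<And>K. K \<ge> L \<Longrightarrow> (real K * B K / a K ^ 3) powr (\<theta> - 1) \<le> H" by blast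
  have R_step: "R k - R (Suc k) = t k" if "k \<ge> N" for k
  proof -
    have "t summable_on {Suc k..}" using summ[of "Suc k"] that by (simp add: t_def)
    then have "infsum t (insert k {Suc k..}) = t k + infsum t {Suc k..}"
      by (intro infsum_insert) auto
    moreover have "insert k {Suc k..} = {k..}" by auto
    ultimately show ?thesis by (simp add: R_def)
  qed
  have R_nonneg: "R k \<ge> 0" for k
  proof -
    \<comment> \<open>At index 0 the values of \<open>\<tau>\<close> and \<open>a\<close> are
      arbitrary, but \<open>0 powr \<theta> = 0\<close>.\<close>
    have "t i \<ge> 0" for i
      using \<tau>[of i] by (cases "i = 0") (auto simp: t_def)
    then show ?thesis unfolding R_def by (intro infsum_nonneg) auto
  qed
  have R_le: "R n \<le> C * W n * real n powr (\<theta> - 1) / a n powr (3 * \<theta>)" if "n \<ge> L" for n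
    using tail[of n] that L a[of n] unfolding R_def t_def[symmetric]
    by (simp add: field_simps)
  \<comment> \<open>Of the power \<open>a powr (3 * \<theta>)\<close> in the bound for
    \<open>R\<close>, one factor \<open>a ^ 3\<close> cancels against the increment of
    \<open>B\<close>; the rest combines with \<open>n powr (\<theta> - 1)\<close> and
    \<open>B powr (\<theta> - 1)\<close> into \<open>u powr (\<theta> - 1)\<close>, which
    \<open>H\<close> bounds.\<close>
  have key: "R (Suc k) * (B (Suc k) powr \<theta> - B k powr \<theta>)
      \<le> C * \<theta> * D * H * ((F (Suc k) - F k) * W (Suc k))" if k: "k \<ge> L" for k
  proof -
    let ?n = "Suc k"
    let ?B = "B ?n" and ?a = "a ?n"
    have an: "?a > 0" using a[of ?n] by simp
    have Fd: "F ?n - F k \<ge> 0" using F by (simp add: mono_def)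
    have "B k \<le> ?B" using B by (simp add: mono_def)
    then have "?B powr \<theta> - B k powr \<theta> \<le> \<theta> * ?B powr (\<theta> - 1) * (?B - B k)"
      using B0 \<theta> by (intro powr_diff_le) auto
    also have "\<dots> \<le> \<theta> * ?B powr (\<theta> - 1) * (D * ?a ^ 3 * (F ?n - F k))"
      using \<theta> incr[of k] k L by (intro mult_left_mono) auto
    finally have "R ?n * (?B powr \<theta> - B k powr \<theta>)
        \<le> R ?n * (\<theta> * ?B powr (\<theta> - 1) * (D * ?a ^ 3 * (F ?n - F k)))"
      using R_nonneg by (intro mult_left_mono)
    also have "\<dots> \<le> (C * W ?n * real ?n powr (\<theta> - 1) / ?a powr (3 * \<theta>))
        * (\<theta> * ?B powr (\<theta> - 1) * (D * ?a ^ 3 * (F ?n - F k)))"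
      using R_le[of ?n] k \<theta> D Fd an by (intro mult_right_mono) auto
    also have "\<dots> = C * \<theta> * D * (real ?n * ?B / ?a ^ 3) powr (\<theta> - 1) * ((F ?n - F k) * W ?n)"
    proof -
      have "?a powr (3 * \<theta>) = ?a ^ 3 * (?a ^ 3) powr (\<theta> - 1)"
      proof -
        have "(?a ^ 3) powr (\<theta> - 1) = (?a powr 3) powr (\<theta> - 1)"
          using an by (simp add: powr_numeral)
        also have "\<dots> = ?a powr (3 * \<theta> - 3)"
          by (simp add: powr_powr algebra_simps)
        also have "\<dots> = ?a powr (3 * \<theta>) / ?a ^ 3"
          using an by (simp add: powr_diff powr_numeral)
        finally show ?thesis using an by simp
      qed
      moreover have "(real ?n * ?B / ?a ^ 3) powr (\<theta> - 1)
          = real ?n powr (\<theta> - 1) * ?B powr (\<theta> - 1) / (?a ^ 3) powr (\<theta> - 1)"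
        using an B0[of ?n] by (simp add: powr_mult powr_divide)
      ultimately show ?thesis
        using an by (simp add: field_simps)
    qed
    also have "\<dots> \<le> C * \<theta> * D * H * ((F ?n - F k) * W ?n)"
      using H(2)[of ?n] k C \<theta> D Fd W_nonneg[of ?n]
      by (intro mult_right_mono mult_left_mono) auto
    finally show ?thesis .
  qed
  define S where "S = R L * B L powr \<theta> + C * \<theta> * D * H *
      ((1 - F L) * W (Suc L) + infsum (\<lambda>n. real n * \<tau> n * (1 - F n)) {1..})"
  have bound: "(\<Sum>k=L..K. t k * B k powr \<theta>) \<le> S" if "L \<le> K" for K
  proof -
    have "(\<Sum>k=L..K. t k * B k powr \<theta>) = (\<Sum>k=L..K. (R k - R (Suc k)) * B k powr \<theta>)"
      using L by (intro sum.cong) (auto simp: R_step)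
    also have "\<dots> \<le> R L * B L powr \<theta> + (\<Sum>k=L..<K. R (Suc k) * (B (Suc k) powr \<theta> - B k powr \<theta>))"
      using abel_sum_powr[OF that, of R "\<lambda>k. B k powr \<theta>"]
        mult_nonneg_nonneg[OF R_nonneg[of "Suc K"] powr_ge_zero[of "B K" \<theta>]] by linarith
    also have "\<dots> \<le> R L * B L powr \<theta>
        + (\<Sum>k=L..<K. C * \<theta> * D * H * ((F (Suc k) - F k) * W (Suc k)))"
      by (intro add_left_mono sum_mono key) auto
    also have "\<dots> \<le> S"
      unfolding S_def sum_distrib_left[symmetric]
      using C \<theta> D H(1) V[OF that] by (intro add_left_mono mult_left_mono) auto
    finally show ?thesis .
  qed
  have eq: "\<tau> n * (real n * B n / a n ^ 3) powr \<theta> = t n * B n powr \<theta>" if "n \<ge> 1" for n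
  proof -
    have "(a n ^ 3) powr \<theta> = a n powr (3 * \<theta>)"
      using a[OF that] by (simp add: powr_powr flip: powr_numeral)
    then show ?thesis
      using a[OF that] B0[of n] that
      by (simp add: t_def powr_mult powr_divide)
  qed
  have tnn: "t n * B n powr \<theta> \<ge> 0" if "n \<ge> 1" for n
    using that \<tau>[of n] by (auto simp: t_def)
  have "(\<lambda>n. t n * B n powr \<theta>) summable_on {L..}"
  proof (rule summable_on_atLeastI_bounded)
    fix K show "(\<Sum>n=L..K. t n * B n powr \<theta>) \<le> max S 0"
      using bound[of K] by (cases "L \<le> K") auto
  qed (use tnn L in auto)
  moreover have "(\<lambda>n. t n * B n powr \<theta>) summable_on {1..<L}"
    by simp
  ultimately have "(\<lambda>n. t n * B n powr \<theta>) summable_on ({1..<L} \<union> {L..})"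
    by (intro summable_on_union)
  moreover have "{1..<L} \<union> {L..} = {1..}" using L by auto
  ultimately have "(\<lambda>n. t n * B n powr \<theta>) summable_on {1..}" by simp
  then show ?thesis
    by (rule summable_on_cong[THEN iffD1, rotated]) (simp add: eq)
qed

section \<open>Moments of bounded random variables\<close>

context prob_space
begin

lemma integrable_powers:
  fixes Y :: "'a \<Rightarrow> real"
  assumes [measurable]: "random_variable borel Y"
    and bnd: "\<And>\<omega>. \<omega> \<in> space M \<Longrightarrow> \<bar>Y \<omega>\<bar> \<le> L"
  shows "integrable M Y" "integrable M (\<lambda>\<omega>. Y \<omega> ^ k)" "integrable M (\<lambda>\<omega>. \<bar>Y \<omega>\<bar> ^ k)"
    "integrable M (\<lambda>\<omega>. exp (h * Y \<omega>))"
proof -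
  have p: "\<bar>Y \<omega>\<bar> ^ j \<le> L ^ j" if "\<omega> \<in> space M" for \<omega> j
    using bnd[OF that] by (intro power_mono) auto
  show "integrable M Y"
    by (rule integrable_const_bound[where B = L]) (use bnd in \<open>auto intro!: AE_I2\<close>)
  show "integrable M (\<lambda>\<omega>. Y \<omega> ^ k)"
    by (rule integrable_const_bound[where B = "L ^ k"]) (use p in \<open>auto intro!: AE_I2 simp: power_abs\<close>)
  show "integrable M (\<lambda>\<omega>. \<bar>Y \<omega>\<bar> ^ k)"
    by (rule integrable_const_bound[where B = "L ^ k"]) (use p in \<open>auto intro!: AE_I2\<close>)
  have "h * Y \<omega> \<le> \<bar>h\<bar> * L" if "\<omega> \<in> space M" for \<omega>
  proof -
    have "h * Y \<omega> \<le> \<bar>h * Y \<omega>\<bar>" by simp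
    also have "\<dots> \<le> \<bar>h\<bar> * L" using bnd[OF that] by (auto simp: abs_mult intro: mult_left_mono)
    finally show ?thesis .
  qed
  then show "integrable M (\<lambda>\<omega>. exp (h * Y \<omega>))"
    by (intro integrable_const_bound[where B = "exp (\<bar>h\<bar> * L)"]) (auto intro!: AE_I2)
qed

text \<open>Integrate \<open>three_mult_le_cube\<close> with \<open>s\<close> the root of the second
  moment: the left side becomes \<open>2 * s ^ 3\<close>.\<close>

lemma sqrt_second_moment_cube_le_third:
  fixes Y :: "'a \<Rightarrow> real"
  assumes Y: "random_variable borel Y" "\<And>\<omega>. \<omega> \<in> space M \<Longrightarrow> \<bar>Y \<omega>\<bar> \<le> L"
  shows "sqrt (expectation (\<lambda>\<omega>. (Y \<omega>)\<^sup>2)) ^ 3 \<le> expectation (\<lambda>\<omega>. \<bar>Y \<omega>\<bar> ^ 3)"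
proof -
  note int = integrable_powers[OF Y]
  define s where "s = sqrt (expectation (\<lambda>\<omega>. (Y \<omega>)\<^sup>2))"
  have s: "s \<ge> 0" "s\<^sup>2 = expectation (\<lambda>\<omega>. (Y \<omega>)\<^sup>2)"
    by (simp_all add: s_def)
  have "expectation (\<lambda>\<omega>. 3 * s * (Y \<omega>)\<^sup>2 - s ^ 3) \<le> expectation (\<lambda>\<omega>. 2 * \<bar>Y \<omega>\<bar> ^ 3)"
    using int three_mult_le_cube[OF s(1) abs_ge_zero] by (intro integral_mono) auto
  also have "expectation (\<lambda>\<omega>. 3 * s * (Y \<omega>)\<^sup>2 - s ^ 3) = 3 * s * s\<^sup>2 - s ^ 3"
    using int by (simp add: s(2) prob_space)
  also have "3 * s * s\<^sup>2 - s ^ 3 = 2 * s ^ 3"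
    by (simp add: power3_eq_cube power2_eq_square)
  finally show ?thesis
    by (simp add: s_def)
qed

section \<open>Exponential moments and a Fuk-Nagaev bound\<close>

lemma expectation_exp_le:
  fixes Y :: "'a \<Rightarrow> real"
  assumes Y: "random_variable borel Y" "\<And>\<omega>. \<omega> \<in> space M \<Longrightarrow> \<bar>Y \<omega>\<bar> \<le> L" and h: "h \<ge> 0"
  shows "expectation (\<lambda>\<omega>. exp (h * Y \<omega>)) \<le> exp (h * expectation Y
      + h\<^sup>2 / 2 * expectation (\<lambda>\<omega>. (Y \<omega>)\<^sup>2) + h ^ 3 / 6 * exp (h * L) * expectation (\<lambda>\<omega>. \<bar>Y \<omega>\<bar> ^ 3))"
proof -
  note int = integrable_powers[OF Y]
  have "exp (h * Y \<omega>) \<le> 1 + h * Y \<omega> + h\<^sup>2 / 2 * (Y \<omega>)\<^sup>2 + h ^ 3 / 6 * exp (h * L) * \<bar>Y \<omega>\<bar> ^ 3"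
    if "\<omega> \<in> space M" for \<omega>
  proof -
    have "exp (h * Y \<omega>) \<le> 1 + h * Y \<omega> + (h * Y \<omega>)\<^sup>2 / 2 + \<bar>h * Y \<omega>\<bar> ^ 3 * exp \<bar>h * Y \<omega>\<bar> / 6"
      by (rule exp_le_cubic)
    also have "\<bar>h * Y \<omega>\<bar> ^ 3 * exp \<bar>h * Y \<omega>\<bar> \<le> \<bar>h * Y \<omega>\<bar> ^ 3 * exp (h * L)"
      using Y(2)[OF that] h by (intro mult_left_mono) (auto simp: abs_mult intro: mult_left_mono)
    finally show ?thesis
      using h by (simp add: abs_mult power_mult_distrib mult_ac)
  qed
  then have "expectation (\<lambda>\<omega>. exp (h * Y \<omega>)) \<le> expectation (\<lambda>\<omega>.
      1 + h * Y \<omega> + h\<^sup>2 / 2 * (Y \<omega>)\<^sup>2 + h ^ 3 / 6 * exp (h * L) * \<bar>Y \<omega>\<bar> ^ 3)"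
    using int by (intro integral_mono) auto
  also have "\<dots> = 1 + (h * expectation Y + h\<^sup>2 / 2 * expectation (\<lambda>\<omega>. (Y \<omega>)\<^sup>2)
      + h ^ 3 / 6 * exp (h * L) * expectation (\<lambda>\<omega>. \<bar>Y \<omega>\<bar> ^ 3))"
    using int by (simp add: prob_space)
  also have "\<dots> \<le> exp (h * expectation Y + h\<^sup>2 / 2 * expectation (\<lambda>\<omega>. (Y \<omega>)\<^sup>2)
      + h ^ 3 / 6 * exp (h * L) * expectation (\<lambda>\<omega>. \<bar>Y \<omega>\<bar> ^ 3))"
    by (rule exp_ge_add_one_self)
  finally show ?thesis .
qed

text \<open>Markov's inequality for the exponential of the sum, with independence turning the
  expectation into a product. Keeping the cubic term apart from the quadratic one lets variance and
  third moment end up in two separate error terms.\<close>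

lemma chernoff_bound_cubic:
  fixes Y :: "'i \<Rightarrow> 'a \<Rightarrow> real" and m T \<beta> :: real
  assumes I: "finite I" and indep: "indep_vars (\<lambda>_. borel) Y I"
    and bnd: "\<And>i \<omega>. i \<in> I \<Longrightarrow> \<omega> \<in> space M \<Longrightarrow> \<bar>Y i \<omega>\<bar> \<le> L"
    and m: "\<And>i. i \<in> I \<Longrightarrow> expectation (Y i) = m"
    and T: "\<And>i. i \<in> I \<Longrightarrow> expectation (\<lambda>\<omega>. (Y i \<omega>)\<^sup>2) = T"
    and \<beta>: "\<And>i. i \<in> I \<Longrightarrow> expectation (\<lambda>\<omega>. \<bar>Y i \<omega>\<bar> ^ 3) = \<beta>"
    and h: "h \<ge> 0"
  shows "prob {\<omega> \<in> space M. (\<Sum>i\<in>I. Y i \<omega>) - card I * m \<ge> t}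
    \<le> exp (card I * (h\<^sup>2 / 2 * T + h ^ 3 / 6 * exp (h * L) * \<beta>) - h * t)"
proof -
  let ?n = "real (card I)"
  have rv: "random_variable borel (Y i)" if "i \<in> I" for i
    using indep that by (simp add: indep_vars_def)
  have int: "integrable M (\<lambda>\<omega>. exp (h * Y i \<omega>))" if "i \<in> I" for i
    by (rule integrable_powers(4)[OF rv bnd]) (use that in auto)
  have indep': "indep_vars (\<lambda>_. borel) (\<lambda>i \<omega>. exp (h * Y i \<omega>)) I"
    by (rule indep_vars_compose2[OF indep]) auto
  have "{\<omega> \<in> space M. (\<Sum>i\<in>I. Y i \<omega>) - ?n * m \<ge> t}
      \<subseteq> {\<omega> \<in> space M. (\<Prod>i\<in>I. exp (h * Y i \<omega>)) \<ge> exp (h * (t + ?n * m))}"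
    using h I by (auto simp: exp_sum[symmetric] sum_distrib_left[symmetric] intro!: mult_left_mono)
  moreover have [measurable]: "(\<lambda>\<omega>. \<Prod>i\<in>I. exp (h * Y i \<omega>)) \<in> borel_measurable M"
    using rv by (intro borel_measurable_prod) auto
  ultimately have "prob {\<omega> \<in> space M. (\<Sum>i\<in>I. Y i \<omega>) - ?n * m \<ge> t}
      \<le> prob {\<omega> \<in> space M. (\<Prod>i\<in>I. exp (h * Y i \<omega>)) \<ge> exp (h * (t + ?n * m))}"
    by (intro finite_measure_mono) auto
  also have "\<dots> \<le> expectation (\<lambda>\<omega>. \<Prod>i\<in>I. exp (h * Y i \<omega>)) / exp (h * (t + ?n * m))"
    by (intro integral_Markov_inequality_measure[where A = "{}"] indep_vars_integrable I indep' int)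
      (auto intro!: AE_I2 prod_nonneg)
  also have "expectation (\<lambda>\<omega>. \<Prod>i\<in>I. exp (h * Y i \<omega>)) = (\<Prod>i\<in>I. expectation (\<lambda>\<omega>. exp (h * Y i \<omega>)))"
    by (rule indep_vars_lebesgue_integral[OF I indep' int])
  also have "\<dots> \<le> (\<Prod>i\<in>I. exp (h * m + h\<^sup>2 / 2 * T + h ^ 3 / 6 * exp (h * L) * \<beta>))"
  proof (rule prod_mono, intro conjI)
    fix i assume i: "i \<in> I"
    show "expectation (\<lambda>\<omega>. exp (h * Y i \<omega>)) \<le> exp (h * m + h\<^sup>2 / 2 * T + h ^ 3 / 6 * exp (h * L) * \<beta>)"
      using expectation_exp_le[OF rv[OF i] bnd[OF i] h] i by (simp add: m T \<beta>)
  qed (auto intro!: integral_nonneg_AE)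
  also have "(\<Prod>i\<in>I. exp (h * m + h\<^sup>2 / 2 * T + h ^ 3 / 6 * exp (h * L) * \<beta>))
      = exp (?n * (h * m + h\<^sup>2 / 2 * T + h ^ 3 / 6 * exp (h * L) * \<beta>))"
    by (simp add: exp_of_nat_mult)
  finally show ?thesis
    by (simp add: divide_right_mono exp_diff[symmetric] algebra_simps)
qed

text \<open>
  Only truncation levels \<open>L\<close> that are small compared to \<open>t\<close> allow the power \<open>\<theta>\<close> of the third
  moment ratio: with \<open>h = 2 \<theta> ln (1 / u) / t\<close> the factor \<open>exp (h * L)\<close> costs at most \<open>u powr (-1/2)\<close>.
\<close>

lemma fuk_nagaev_one_sided:
  fixes Y :: "'i \<Rightarrow> 'a \<Rightarrow> real" and m T \<beta> :: real
  assumes I: "finite I" and indep: "indep_vars (\<lambda>_. borel) Y I"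
    and bnd: "\<And>i \<omega>. i \<in> I \<Longrightarrow> \<omega> \<in> space M \<Longrightarrow> \<bar>Y i \<omega>\<bar> \<le> L"
    and m: "\<And>i. i \<in> I \<Longrightarrow> expectation (Y i) = m"
    and T: "\<And>i. i \<in> I \<Longrightarrow> expectation (\<lambda>\<omega>. (Y i \<omega>)\<^sup>2) = T"
    and \<beta>: "\<And>i. i \<in> I \<Longrightarrow> expectation (\<lambda>\<omega>. \<bar>Y i \<omega>\<bar> ^ 3) = \<beta>"
    and \<theta>: "\<theta> \<ge> 1" and t: "t > 0" and L: "4 * \<theta> * L \<le> t"
  shows "prob {\<omega> \<in> space M. (\<Sum>i\<in>I. Y i \<omega>) - card I * m \<ge> t}
    \<le> exp (288 * \<theta> ^ 3) * (exp_neg_quot (t\<^sup>2 / 2) (card I * T) + (card I * \<beta> / t ^ 3) powr \<theta>)"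
    (is "?P \<le> ?D * (?G + ?u powr \<theta>)")
proof -
  let ?n = "real (card I)"
  have rv: "random_variable borel (Y i)" if "i \<in> I" for i
    using indep that by (simp add: indep_vars_def)
  have D1: "?D \<ge> 1" using \<theta> by simp
  have G0: "?G \<ge> 0" by (simp add: exp_neg_quot_def)
  have rhs: "x \<le> ?D * (?G + ?u powr \<theta>)" if "x \<le> ?D * ?G \<or> x \<le> ?D * ?u powr \<theta>" for x
    using that G0 D1 by (auto simp: distrib_left intro: order_trans add_increasing2 add_increasing)
  consider "I = {}" | "I \<noteq> {}" "T = 0" | "I \<noteq> {}" "T \<noteq> 0" by blast
  then show ?thesis
  proof cases
    case 1
    then show ?thesis using t G0 by simp
  next
    \<comment> \<open>The summands vanish almost surely, so the probability is 0, in agreement with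
      the convention in \<open>exp_neg_quot\<close>; the choice of \<open>h\<close> made below would
      divide by 0.\<close>
    case 2
    have AE0: "AE \<omega> in M. Y i \<omega> = 0" if i: "i \<in> I" for i
    proof -
      have "AE \<omega> in M. (Y i \<omega>)\<^sup>2 = 0"
        using integral_nonneg_eq_0_iff_AE[of M "\<lambda>\<omega>. (Y i \<omega>)\<^sup>2"]
          integrable_powers(2)[OF rv[OF i] bnd[OF i], where k = 2] T[OF i] 2 by auto
      then show ?thesis by simp
    qed
    then have "AE \<omega> in M. \<forall>i\<in>I. Y i \<omega> = 0"
      using I by (simp add: AE_finite_all)
    moreover obtain i where i: "i \<in> I" using 2 by auto
    then have "m = 0"
      using integral_cong_AE[of "Y i" M "\<lambda>_. 0"] AE0 rv m by auto
    ultimately have "AE \<omega> in M. \<not> (\<Sum>i\<in>I. Y i \<omega>) - ?n * m \<ge> t"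
      using t by (auto elim!: eventually_mono)
    then have "?P = 0"
      using rv by (intro prob_eq_0_AE) auto
    then show ?thesis using G0 by simp
  next
    case 3
    obtain i where i: "i \<in> I" using 3 by auto
    have n: "?n > 0" using 3 I by (simp add: card_gt_0_iff)
    have "T \<ge> 0" using T[OF i] by (auto simp flip: T[OF i] intro!: integral_nonneg_AE)
    with 3 have T0: "T > 0" by simp
    have "sqrt T ^ 3 \<le> \<beta>"
      using sqrt_second_moment_cube_le_third[OF rv[OF i] bnd[OF i]] i by (simp add: T \<beta>)
    with T0 have \<beta>0: "\<beta> > 0"
      by (smt (verit) real_sqrt_gt_zero zero_less_power)
    have u: "?u > 0" using \<beta>0 n t by simp
    have L0: "L \<ge> 0"
      using bnd[OF i] not_empty by (force intro: order_trans[OF abs_ge_zero])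
    show ?thesis
    proof (cases "?u \<ge> 1")
      case True
      have "?P \<le> 1" by simp
      also have "1 \<le> ?u powr \<theta>" using True \<theta> by (simp add: ge_one_powr_ge_zero)
      also have "\<dots> \<le> ?D * ?u powr \<theta>" using D1 by (simp add: mult_le_cancel_right1)
      finally show ?thesis using rhs by blast
    next
      case False
      define l where "l = - ln ?u"
      have l: "l > 0" "?u = exp (- l)" using u False by (auto simp: l_def)
      \<comment> \<open>The first candidate minimises \<open>h\<^sup>2 * n * T / 2 - h * t\<close>;
        the second makes \<open>exp (- h * t / 2)\<close> equal to \<open>?u powr \<theta>\<close>.
        Taking the smaller, half of \<open>h * t\<close> pays for the quadratic term and the other
        half is the gain.\<close>
      define h where "h = min (t / (?n * T)) (2 * \<theta> * l / t)"
      have h: "h > 0" using n T0 t \<theta> l by (simp add: h_def)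
      have ht: "h * t \<le> 2 * \<theta> * l"
        using t by (simp add: h_def min_def field_simps)
      have "h * (?n * T) \<le> t"
        using n T0 by (simp add: h_def min_def field_simps)
      then have "h * (h * (?n * T)) \<le> h * t"
        using h by (intro mult_left_mono) auto
      then have quad: "?n * (h\<^sup>2 / 2 * T) \<le> h * t / 2"
        by (simp add: power2_eq_square algebra_simps)
      have hL: "h * L \<le> l / 2"
      proof -
        have "4 * \<theta> * (h * L) \<le> h * t"
          using mult_left_mono[OF L less_imp_le[OF h]] by (simp add: algebra_simps)
        also note ht
        finally show ?thesis using \<theta> by (simp add: field_simps)
      qed
      have "?n * (h ^ 3 / 6 * exp (h * L) * \<beta>) = (h * t) ^ 3 * ?u * exp (h * L) / 6"
        using t by (simp add: power_mult_distrib)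
      also have "\<dots> \<le> (2 * \<theta> * l) ^ 3 * ?u * exp (l / 2) / 6"
      proof -
        have "(h * t) ^ 3 \<le> (2 * \<theta> * l) ^ 3"
          using h t by (intro power_mono[OF ht]) auto
        then have "(h * t) ^ 3 * ?u \<le> (2 * \<theta> * l) ^ 3 * ?u"
          using u by (rule mult_right_mono[OF _ less_imp_le])
        then have "(h * t) ^ 3 * ?u * exp (h * L) \<le> (2 * \<theta> * l) ^ 3 * ?u * exp (l / 2)"
          using h t u hL \<theta> l by (intro mult_mono) auto
        then show ?thesis by (rule divide_right_mono) simp
      qed
      \<comment> \<open>The factor \<open>?u = exp (- l)\<close> absorbs \<open>exp (l / 2)\<close>;
        then \<open>8 / 6 * 216 = 288\<close> gives the constant of the statement.\<close>
      also have "\<dots> = 8 / 6 * \<theta> ^ 3 * (l ^ 3 * exp (- l / 2))"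
        unfolding l(2) by (simp add: power_mult_distrib flip: exp_add)
      also have "\<dots> \<le> 8 / 6 * \<theta> ^ 3 * 216"
        using l \<theta> by (intro mult_left_mono cube_exp_half_le) auto
      finally have cub: "?n * (h ^ 3 / 6 * exp (h * L) * \<beta>) \<le> 288 * \<theta> ^ 3" by simp
      have "?P \<le> exp (?n * (h\<^sup>2 / 2 * T + h ^ 3 / 6 * exp (h * L) * \<beta>) - h * t)"
        by (rule chernoff_bound_cubic[OF I indep bnd m T \<beta>]) (use h in auto)
      also have "\<dots> \<le> exp (288 * \<theta> ^ 3 + (- (h * t) / 2))"
        using quad cub by (simp add: distrib_left)
      also have "\<dots> = ?D * exp (- (h * t) / 2)"
        by (simp only: exp_add)
      finally have P: "?P \<le> ?D * exp (- (h * t) / 2)" .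
      have "h = t / (?n * T) \<or> h = 2 * \<theta> * l / t"
        unfolding h_def using linear[of "t / (?n * T)" "2 * \<theta> * l / t"] by (elim disjE) (simp_all only: min_absorb1 min_absorb2 simp_thms)
      then consider "h = t / (?n * T)" | "h = 2 * \<theta> * l / t"
        by blast
      then have "exp (- (h * t) / 2) = ?G \<or> exp (- (h * t) / 2) = ?u powr \<theta>"
      proof cases
        case 1
        then show ?thesis
          using n T0 by (simp add: exp_neg_quot_def power2_eq_square)
      next
        case 2
        then have "exp (- (h * t) / 2) = exp (\<theta> * (- l))" using t by simp
        also have "\<dots> = exp (- l) powr \<theta>" by (simp add: powr_def)
        finally show ?thesis using l(2) by simp
      qed
      then show ?thesis
      proof
        assume "exp (- (h * t) / 2) = ?G"
        with P show ?thesis by (intro rhs disjI1) (simp only:)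
      next
        assume "exp (- (h * t) / 2) = ?u powr \<theta>"
        with P show ?thesis by (intro rhs disjI2) (simp only:)
      qed
    qed
  qed
qed

lemma fuk_nagaev:
  fixes Y :: "'i \<Rightarrow> 'a \<Rightarrow> real" and m T \<beta> :: real
  assumes I: "finite I" and indep: "indep_vars (\<lambda>_. borel) Y I"
    and bnd: "\<And>i \<omega>. i \<in> I \<Longrightarrow> \<omega> \<in> space M \<Longrightarrow> \<bar>Y i \<omega>\<bar> \<le> L"
    and m: "\<And>i. i \<in> I \<Longrightarrow> expectation (Y i) = m"
    and T: "\<And>i. i \<in> I \<Longrightarrow> expectation (\<lambda>\<omega>. (Y i \<omega>)\<^sup>2) = T"
    and \<beta>: "\<And>i. i \<in> I \<Longrightarrow> expectation (\<lambda>\<omega>. \<bar>Y i \<omega>\<bar> ^ 3) = \<beta>"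
    and \<theta>: "\<theta> \<ge> 1" and t: "t > 0" and L: "4 * \<theta> * L \<le> t"
  shows "prob {\<omega> \<in> space M. \<bar>(\<Sum>i\<in>I. Y i \<omega>) - card I * m\<bar> \<ge> t}
    \<le> 2 * exp (288 * \<theta> ^ 3) * (exp_neg_quot (t\<^sup>2 / 2) (card I * T) + (card I * \<beta> / t ^ 3) powr \<theta>)"
proof -
  let ?D = "exp (288 * \<theta> ^ 3) * (exp_neg_quot (t\<^sup>2 / 2) (card I * T) + (card I * \<beta> / t ^ 3) powr \<theta>)"
  have rv[measurable]: "random_variable borel (Y i)" if "i \<in> I" for i
    using indep that by (simp add: indep_vars_def)
  have S[measurable]: "random_variable borel (\<lambda>\<omega>. \<Sum>i\<in>I. Y i \<omega>)"
    by measurable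
  have indep': "indep_vars (\<lambda>_. borel) (\<lambda>i \<omega>. - Y i \<omega>) I"
    by (rule indep_vars_compose2[OF indep]) auto
  have "prob {\<omega> \<in> space M. (\<Sum>i\<in>I. - Y i \<omega>) - card I * (- m) \<ge> t} \<le> ?D"
    by (rule fuk_nagaev_one_sided[OF I indep' _ _ _ _ \<theta> t L])
      (auto simp: bnd m T \<beta>)
  moreover have "prob {\<omega> \<in> space M. (\<Sum>i\<in>I. Y i \<omega>) - card I * m \<ge> t} \<le> ?D"
    by (rule fuk_nagaev_one_sided[OF I indep bnd m T \<beta> \<theta> t L])
  moreover have "prob {\<omega> \<in> space M. \<bar>(\<Sum>i\<in>I. Y i \<omega>) - card I * m\<bar> \<ge> t}
      \<le> prob ({\<omega> \<in> space M. (\<Sum>i\<in>I. Y i \<omega>) - card I * m \<ge> t}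
        \<union> {\<omega> \<in> space M. (\<Sum>i\<in>I. - Y i \<omega>) - card I * (- m) \<ge> t})"
    by (intro finite_measure_mono) (auto simp: sum_negf)
  moreover have "\<dots> \<le> prob {\<omega> \<in> space M. (\<Sum>i\<in>I. Y i \<omega>) - card I * m \<ge> t}
      + prob {\<omega> \<in> space M. (\<Sum>i\<in>I. - Y i \<omega>) - card I * (- m) \<ge> t}"
    by (intro measure_subadditive) (auto simp: sum_negf)
  ultimately show ?thesis by simp
qed

end

section \<open>Lower bounds for sums of centred bounded variables\<close>

text \<open>A polynomial test function for a one-sided bound: the term \<open>2 * z\<close> has no
  effect on the expectation of a centred variable, yet it pushes the polynomial below 0 for negative
  \<open>z\<close>.\<close>

lemma quartic_minorant:
  fixes z :: real
  shows "2 * z + z\<^sup>2 - z ^ 4 / 16 - 1 / 4 \<le> 11 * indicator {1 / 10..} z"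
proof -
  consider "z \<ge> 1 / 10" | "0 \<le> z" "z < 1 / 10" | "z < 0" by linarith
  then show ?thesis
  proof cases
    case 1
    \<comment> \<open>The squares expand to
      \<open>z ^ 4 / 16 - z\<^sup>2 - 2 * z + 41 / 4\<close>.\<close>
    have "0 \<le> (z\<^sup>2 / 4 - 5 / 2)\<^sup>2 + (z - 4)\<^sup>2 / 4" by simp
    then have "2 * z + z\<^sup>2 - z ^ 4 / 16 \<le> 11"
      by (simp add: power2_eq_square power4_eq_xxxx field_simps)
    then show ?thesis using 1 by (simp add: indicator_def)
  next
    case 2
    have "z\<^sup>2 \<le> (1 / 10)\<^sup>2" using 2 by (intro power_mono) auto
    then have "2 * z + z\<^sup>2 \<le> 1 / 4" using 2 by (simp add: power2_eq_square)
    moreover have "indicator {1 / 10..} z = (0::real)" using 2 by (simp add: indicator_def)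
    moreover have "z ^ 4 \<ge> 0" by simp
    ultimately show ?thesis by linarith
  next
    case 3
    \<comment> \<open>With \<open>y = - z\<close> this says that \<open>y ^ 3\<close> lies above its
      tangent at \<open>5 / 2\<close>, namely \<open>75 / 4 * y - 125 / 4\<close>.\<close>
    have "0 \<le> (- z - 5 / 2)\<^sup>2 * (- z + 5)" using 3 by (intro mult_nonneg_nonneg) auto
    then have "- (z ^ 3) \<ge> - 75 / 4 * z - 125 / 4"
      by (simp add: power2_eq_square power3_eq_cube field_simps)
    then have "2 + z - z ^ 3 / 16 \<ge> 0" using 3 by simp
    then have "z * (2 + z - z ^ 3 / 16) \<le> 0" using 3 by (simp add: mult_nonpos_nonneg)
    then have "2 * z + z\<^sup>2 - z ^ 4 / 16 \<le> 0"
      by (simp add: algebra_simps power2_eq_square power3_eq_cube power4_eq_xxxx)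
    moreover have "indicator {1 / 10..} z = (0::real)" using 3 by (simp add: indicator_def)
    ultimately show ?thesis by linarith
  qed
qed

lemma card_residue_class_ge:
  fixes n m j :: nat
  assumes "j < m"
  shows "n div m \<le> card {i \<in> {1..n}. i mod m = j}"
proof -
  \<comment> \<open>Indices start at 1, so the residue class of 0 has least element
    \<open>m\<close>.\<close>
  define r where "r = (if j = 0 then m else j)"
  have r: "r \<le> m" "1 \<le> r" "r mod m = j" using assms by (auto simp: r_def)
  have "q * m + r \<in> {i \<in> {1..n}. i mod m = j}" if "q < n div m" for q
  proof -
    have "q * m + r \<le> Suc q * m" using r by simp
    also have "\<dots> \<le> n div m * m" using that by (intro mult_le_mono1) simp
    also have "\<dots> \<le> n" by (rule div_times_less_eq_dividend)
    finally have "q * m + r \<le> n" .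
    moreover have "(q * m + r) mod m = j"
      by (simp only: mod_mult_self3 r(3))
    ultimately show ?thesis using r(2) by simp
  qed
  then have "(\<lambda>q. q * m + r) ` {..<n div m} \<subseteq> {i \<in> {1..n}. i mod m = j}"
    by blast
  then have "card ((\<lambda>q. q * m + r) ` {..<n div m}) \<le> card {i \<in> {1..n}. i mod m = j}"
    by (rule card_mono[rotated]) simp
  moreover have "inj_on (\<lambda>q. q * m + r) {..<n div m}"
    using assms by (simp add: inj_on_def)
  ultimately show ?thesis by (simp add: card_image)
qed

context prob_space
begin

text \<open>The minorant \<open>quartic_minorant\<close> at \<open>Z / s\<close> has expectation at
  least \<open>1 - 1 / 4 - 1 / 4 = 1 / 2\<close> and is at most 11 times the indicator, whence
  \<open>1 / 22\<close>.\<close>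

lemma prob_ge_tenth_std:
  fixes Z :: "'a \<Rightarrow> real"
  assumes Z: "random_variable borel Z" "\<And>\<omega>. \<omega> \<in> space M \<Longrightarrow> \<bar>Z \<omega>\<bar> \<le> L"
    and s: "s > 0" and m1: "expectation Z = 0" and m2: "expectation (\<lambda>\<omega>. (Z \<omega>)\<^sup>2) = s\<^sup>2"
    and m4: "expectation (\<lambda>\<omega>. Z \<omega> ^ 4) \<le> 4 * s ^ 4"
  shows "1 / 22 \<le> prob {\<omega> \<in> space M. Z \<omega> \<ge> s / 10}"
proof -
  note int = integrable_powers[OF Z]
  note [measurable] = Z(1)
  define A where "A = {\<omega> \<in> space M. Z \<omega> \<ge> s / 10}"
  have A[measurable]: "A \<in> events" unfolding A_def by measurable
  have "1 / 2 \<le> 2 / s * expectation Z + expectation (\<lambda>\<omega>. (Z \<omega>)\<^sup>2) / s\<^sup>2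
      - expectation (\<lambda>\<omega>. Z \<omega> ^ 4) / (16 * s ^ 4) - 1 / 4"
    using s m4 by (simp add: m1 m2 field_simps)
  also have "\<dots> = expectation (\<lambda>\<omega>. 2 / s * Z \<omega> + (Z \<omega>)\<^sup>2 / s\<^sup>2 - Z \<omega> ^ 4 / (16 * s ^ 4) - 1 / 4)"
    using int by (simp add: prob_space)
  also have "\<dots> \<le> expectation (\<lambda>\<omega>. 11 * indicator A \<omega>)"
  proof (rule integral_mono)
    fix \<omega> assume "\<omega> \<in> space M"
    then have "indicator {1 / 10..} (Z \<omega> / s) = (indicator A \<omega> :: real)"
      using s by (auto simp: indicator_def A_def field_simps)
    then show "2 / s * Z \<omega> + (Z \<omega>)\<^sup>2 / s\<^sup>2 - Z \<omega> ^ 4 / (16 * s ^ 4) - 1 / 4 \<le> 11 * indicator A \<omega>"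
      using quartic_minorant[of "Z \<omega> / s"] by (simp add: power_divide mult.commute)
  qed (use int in \<open>auto simp: less_top[symmetric]\<close>)
  also have "\<dots> = 11 * prob A" by simp
  finally show ?thesis unfolding A_def by simp
qed

lemma expectation_indep_powers:
  fixes Y Z :: "'a \<Rightarrow> real"
  assumes indep: "indep_var borel Y borel Z"
    and Y: "\<And>\<omega>. \<omega> \<in> space M \<Longrightarrow> \<bar>Y \<omega>\<bar> \<le> L" and Z: "\<And>\<omega>. \<omega> \<in> space M \<Longrightarrow> \<bar>Z \<omega>\<bar> \<le> K"
  shows "expectation (\<lambda>\<omega>. Y \<omega> ^ a * Z \<omega> ^ b) = expectation (\<lambda>\<omega>. Y \<omega> ^ a) * expectation (\<lambda>\<omega>. Z \<omega> ^ b)"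
    and "integrable M (\<lambda>\<omega>. Y \<omega> ^ a * Z \<omega> ^ b)"
proof -
  have rv: "random_variable borel Y" "random_variable borel Z"
    using indep_var_rv1[OF indep] indep_var_rv2[OF indep] by auto
  have "indep_var borel ((\<lambda>x. x ^ a) \<circ> Y) borel ((\<lambda>x. x ^ b) \<circ> Z)"
    by (rule indep_var_compose[OF indep]) auto
  then have i: "indep_var borel (\<lambda>\<omega>. Y \<omega> ^ a) borel (\<lambda>\<omega>. Z \<omega> ^ b)"
    by (simp add: comp_def)
  have j: "integrable M (\<lambda>\<omega>. Y \<omega> ^ a)" "integrable M (\<lambda>\<omega>. Z \<omega> ^ b)"
    using integrable_powers(2) rv Y Z by blast+
  show "expectation (\<lambda>\<omega>. Y \<omega> ^ a * Z \<omega> ^ b) = expectation (\<lambda>\<omega>. Y \<omega> ^ a) * expectation (\<lambda>\<omega>. Z \<omega> ^ b)"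
    by (rule indep_var_lebesgue_integral[OF i j])
  show "integrable M (\<lambda>\<omega>. Y \<omega> ^ a * Z \<omega> ^ b)"
    by (rule indep_var_integrable[OF i j])
qed

lemma abs_sum_le_card:
  fixes Y :: "'i \<Rightarrow> 'a \<Rightarrow> real" and L :: real
  assumes "\<And>i. i \<in> I \<Longrightarrow> \<bar>Y i \<omega>\<bar> \<le> L"
  shows "\<bar>\<Sum>i\<in>I. Y i \<omega>\<bar> \<le> card I * L"
  using sum_norm_bound[of I "\<lambda>i. Y i \<omega>" L] assms by auto

text \<open>Induction on \<open>I\<close>: mixed terms containing a first power vanish by
  independence and centring. In the fourth moment the new term \<open>6 * card I * s ^ 4\<close>
  fits into the increment of \<open>3 * (card I)\<^sup>2 * s ^ 4\<close>.\<close>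

lemma sum_centred_moments:
  fixes Y :: "'i \<Rightarrow> 'a \<Rightarrow> real" and s \<kappa> L :: real
  assumes "finite I" and "indep_vars (\<lambda>_. borel) Y I"
    and "\<And>i \<omega>. i \<in> I \<Longrightarrow> \<omega> \<in> space M \<Longrightarrow> \<bar>Y i \<omega>\<bar> \<le> L"
    and "\<And>i. i \<in> I \<Longrightarrow> expectation (Y i) = 0"
    and "\<And>i. i \<in> I \<Longrightarrow> expectation (\<lambda>\<omega>. (Y i \<omega>)\<^sup>2) = s\<^sup>2"
    and "\<And>i. i \<in> I \<Longrightarrow> expectation (\<lambda>\<omega>. Y i \<omega> ^ 4) = \<kappa>"
  shows "expectation (\<lambda>\<omega>. \<Sum>i\<in>I. Y i \<omega>) = 0"
    and "expectation (\<lambda>\<omega>. (\<Sum>i\<in>I. Y i \<omega>)\<^sup>2) = card I * s\<^sup>2"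
    and "expectation (\<lambda>\<omega>. (\<Sum>i\<in>I. Y i \<omega>) ^ 4) \<le> card I * \<kappa> + 3 * (card I)\<^sup>2 * s ^ 4"
proof -
  have "expectation (\<lambda>\<omega>. \<Sum>i\<in>I. Y i \<omega>) = 0 \<and>
    expectation (\<lambda>\<omega>. (\<Sum>i\<in>I. Y i \<omega>)\<^sup>2) = card I * s\<^sup>2 \<and>
    expectation (\<lambda>\<omega>. (\<Sum>i\<in>I. Y i \<omega>) ^ 4) \<le> card I * \<kappa> + 3 * (card I)\<^sup>2 * s ^ 4"
    using assms
  proof (induction I rule: finite_induct)
    case (insert i I)
    let ?Y = "Y i" and ?S = "\<lambda>\<omega>. \<Sum>i\<in>I. Y i \<omega>" and ?n = "real (card I)"
    have IH: "expectation ?S = 0" "expectation (\<lambda>\<omega>. (?S \<omega>)\<^sup>2) = ?n * s\<^sup>2"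
      "expectation (\<lambda>\<omega>. ?S \<omega> ^ 4) \<le> ?n * \<kappa> + 3 * ?n\<^sup>2 * s ^ 4"
      using insert.IH[OF indep_vars_subset[OF insert.prems(1)]] insert.prems by auto
    have ind: "indep_var borel ?Y borel ?S"
      by (rule indep_vars_sum[OF insert.hyps insert.prems(1)])
    have bY: "\<bar>?Y \<omega>\<bar> \<le> L" if "\<omega> \<in> space M" for \<omega>
      using insert.prems(2) that by auto
    have bS: "\<bar>?S \<omega>\<bar> \<le> ?n * L" if "\<omega> \<in> space M" for \<omega>
      using abs_sum_le_card[of I Y \<omega> L] insert.prems(2) that by auto
    have pw: "expectation (\<lambda>\<omega>. ?Y \<omega> ^ a * ?S \<omega> ^ b) = expectation (\<lambda>\<omega>. ?Y \<omega> ^ a) * expectation (\<lambda>\<omega>. ?S \<omega> ^ b)"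
      "integrable M (\<lambda>\<omega>. ?Y \<omega> ^ a * ?S \<omega> ^ b)" for a b
      by (rule expectation_indep_powers[OF ind bY bS], assumption+)+
    have rv: "random_variable borel ?Y" "random_variable borel ?S"
      using indep_var_rv1[OF ind] indep_var_rv2[OF ind] by auto
    note int = integrable_powers[OF rv(1) bY] integrable_powers[OF rv(2) bS]
    have Y: "expectation ?Y = 0" "expectation (\<lambda>\<omega>. (?Y \<omega>)\<^sup>2) = s\<^sup>2" "expectation (\<lambda>\<omega>. ?Y \<omega> ^ 4) = \<kappa>"
      using insert.prems by auto
    have sum: "(\<Sum>i\<in>insert i I. Y i \<omega>) = ?Y \<omega> + ?S \<omega>" for \<omega>
      using insert.hyps by simp
    have 1: "expectation (\<lambda>\<omega>. ?Y \<omega> + ?S \<omega>) = 0"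
      using int IH Y by simp
    have "expectation (\<lambda>\<omega>. (?Y \<omega> + ?S \<omega>)\<^sup>2)
        = expectation (\<lambda>\<omega>. (?Y \<omega>)\<^sup>2 + 2 * (?Y \<omega> ^ 1 * ?S \<omega> ^ 1) + (?S \<omega>)\<^sup>2)"
      by (intro Bochner_Integration.integral_cong) (auto simp: power2_eq_square algebra_simps)
    also have "\<dots> = s\<^sup>2 + ?n * s\<^sup>2"
      using int pw(1)[of 1 1] pw(2)[of 1 1] by (simp add: Y IH)
    finally have 2: "expectation (\<lambda>\<omega>. (?Y \<omega> + ?S \<omega>)\<^sup>2) = (?n + 1) * s\<^sup>2"
      by (simp add: algebra_simps)
    have "expectation (\<lambda>\<omega>. (?Y \<omega> + ?S \<omega>) ^ 4)
        = expectation (\<lambda>\<omega>. ?Y \<omega> ^ 4 + 4 * (?Y \<omega> ^ 3 * ?S \<omega> ^ 1) + 6 * (?Y \<omega> ^ 2 * ?S \<omega> ^ 2)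
            + 4 * (?Y \<omega> ^ 1 * ?S \<omega> ^ 3) + ?S \<omega> ^ 4)"
      by (intro Bochner_Integration.integral_cong)
        (auto simp: power2_eq_square power3_eq_cube power4_eq_xxxx algebra_simps)
    also have "\<dots> = expectation (\<lambda>\<omega>. ?Y \<omega> ^ 4) + 4 * expectation (\<lambda>\<omega>. ?Y \<omega> ^ 3 * ?S \<omega> ^ 1)
            + 6 * expectation (\<lambda>\<omega>. ?Y \<omega> ^ 2 * ?S \<omega> ^ 2)
            + 4 * expectation (\<lambda>\<omega>. ?Y \<omega> ^ 1 * ?S \<omega> ^ 3) + expectation (\<lambda>\<omega>. ?S \<omega> ^ 4)"
      using int(2,6) pw(2)[of 3 1] pw(2)[of 2 2] pw(2)[of 1 3]
      by (simp del: power_one_right)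
    also have "\<dots> = \<kappa> + 6 * (s\<^sup>2 * (?n * s\<^sup>2)) + expectation (\<lambda>\<omega>. ?S \<omega> ^ 4)"
      unfolding pw(1) by (simp add: Y IH)
    also have "\<dots> \<le> \<kappa> + 6 * (s\<^sup>2 * (?n * s\<^sup>2)) + (?n * \<kappa> + 3 * ?n\<^sup>2 * s ^ 4)"
      using IH by simp
    also have "\<dots> \<le> (?n + 1) * \<kappa> + 3 * (?n + 1)\<^sup>2 * s ^ 4"
    proof -
      have "0 \<le> s * (s * (s * s))"
        using zero_le_even_power[of 4 s] by (simp add: power4_eq_xxxx mult.assoc)
      then show ?thesis
        by (simp add: power2_eq_square power4_eq_xxxx algebra_simps)
    qed
    finally show ?case
      using insert.hyps 1 2 unfolding sum by (simp add: add.commute)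
  qed simp
  then show "expectation (\<lambda>\<omega>. \<Sum>i\<in>I. Y i \<omega>) = 0"
    "expectation (\<lambda>\<omega>. (\<Sum>i\<in>I. Y i \<omega>)\<^sup>2) = card I * s\<^sup>2"
    "expectation (\<lambda>\<omega>. (\<Sum>i\<in>I. Y i \<omega>) ^ 4) \<le> card I * \<kappa> + 3 * (card I)\<^sup>2 * s ^ 4"
    by auto
qed

text \<open>
  Split the index set into \<open>m\<close> residue classes: if every block sum exceeds a tenth of its standard
  deviation, the total exceeds a multiple of its own standard deviation that grows like \<open>sqrt m\<close>.
\<close>

lemma sum_exceeds_by_blocks:
  fixes Y :: "nat \<Rightarrow> 'a \<Rightarrow> real" and s \<kappa> L :: real
  assumes indep: "indep_vars (\<lambda>_. borel) Y {1..n}"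
    and bnd: "\<And>i \<omega>. i \<in> {1..n} \<Longrightarrow> \<omega> \<in> space M \<Longrightarrow> \<bar>Y i \<omega>\<bar> \<le> L"
    and m1: "\<And>i. i \<in> {1..n} \<Longrightarrow> expectation (Y i) = 0"
    and m2: "\<And>i. i \<in> {1..n} \<Longrightarrow> expectation (\<lambda>\<omega>. (Y i \<omega>)\<^sup>2) = s\<^sup>2"
    and m4: "\<And>i. i \<in> {1..n} \<Longrightarrow> expectation (\<lambda>\<omega>. Y i \<omega> ^ 4) = \<kappa>"
    and s: "s > 0" and m: "1 \<le> m" "m \<le> n" and \<kappa>: "\<kappa> \<le> n / (2 * m) * s ^ 4"
  shows "(1 / 22) ^ m \<le> prob {\<omega> \<in> space M. (\<Sum>i=1..n. Y i \<omega>) \<ge> s * sqrt (n * m / 2) / 10}"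
proof -
  define K where "K = (\<lambda>j. {i \<in> {1..n}. i mod m = j})"
  define B where "B = (\<lambda>j \<omega>. \<Sum>i\<in>K j. Y i \<omega>)"
  define r where "r = s * sqrt (n / (2 * m)) / 10"
  have fin: "finite (K j)" and sub: "K j \<subseteq> {1..n}" for j
    by (auto simp: K_def)
  have rv: "random_variable borel (Y i)" if "i \<in> {1..n}" for i
    using indep that by (simp add: indep_vars_def)
  have Brv[measurable]: "random_variable borel (B j)" for j
    unfolding B_def by (intro borel_measurable_sum) (use sub rv in blast)
  have "indep_vars (\<lambda>j. PiM (K j) (\<lambda>_. borel)) (\<lambda>j \<omega>. restrict (\<lambda>i. Y i \<omega>) (K j)) {..<m}"
    using sub by (intro indep_vars_restrict[OF indep]) (auto simp: disjoint_family_on_def K_def)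
  then have "indep_vars (\<lambda>_. borel) (\<lambda>j \<omega>. \<Sum>i\<in>K j. (restrict (\<lambda>i. Y i \<omega>) (K j)) i) {..<m}"
    by (rule indep_vars_compose2[where Y = "\<lambda>j f. \<Sum>i\<in>K j. f i"]) auto
  then have Bind: "indep_vars (\<lambda>_. borel) B {..<m}"
    by (simp add: B_def cong: sum.cong)
  have block: "1 / 22 \<le> prob (B j -` {r..} \<inter> space M)" if j: "j < m" for j
  proof -
    let ?k = "real (card (K j))"
    \<comment> \<open>Rounding \<open>n / m\<close> down loses at most a factor 2, because
      \<open>m \<le> n\<close>.\<close>
    have "real n / (2 * m) \<le> real (n div m)"
    proof -
      have "n < m * Suc (n div m)"
        using dividend_less_times_div[of m n] m by simp
      also have "\<dots> \<le> m * (2 * (n div m))"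
        using m by (intro mult_left_mono) (auto simp: div_greater_zero_iff Suc_le_eq)
      finally have "real n \<le> real (m * (2 * (n div m)))" by linarith
      then show ?thesis using m by (simp add: field_simps)
    qed
    also have "\<dots> \<le> ?k"
      using card_residue_class_ge[OF j, of n] by (simp add: K_def)
    finally have k: "real n / (2 * m) \<le> ?k" .
    have k0: "?k > 0" using m by (intro less_le_trans[OF _ k]) simp
    have mom: "expectation (B j) = 0" "expectation (\<lambda>\<omega>. (B j \<omega>)\<^sup>2) = ?k * s\<^sup>2"
      "expectation (\<lambda>\<omega>. B j \<omega> ^ 4) \<le> ?k * \<kappa> + 3 * ?k\<^sup>2 * s ^ 4"
      unfolding B_def
      using sum_centred_moments[OF fin indep_vars_subset[OF indep sub], of j L s \<kappa>]
        bnd m1 m2 m4 sub[of j] by (simp_all add: subset_iff)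
    \<comment> \<open>The hypothesis on \<open>\<kappa>\<close> adds one more squared block variance
      to the three from \<open>mom(3)\<close>; this is the factor 4 that
      \<open>prob_ge_tenth_std\<close> allows.\<close>
    have "\<kappa> \<le> ?k * s ^ 4"
      using \<kappa> mult_right_mono[OF k, of "s ^ 4"] by simp
    then have "?k * \<kappa> \<le> ?k * (?k * s ^ 4)"
      by (rule mult_left_mono) simp
    moreover have "3 * ?k\<^sup>2 * s ^ 4 = 3 * (?k * (?k * s ^ 4))"
      by (simp add: power2_eq_square)
    moreover have "(s * sqrt ?k) ^ 4 = ?k * (?k * s ^ 4)"
      by (simp add: power_mult_distrib power4_eq_xxxx)
    ultimately have "expectation (\<lambda>\<omega>. B j \<omega> ^ 4) \<le> 4 * (s * sqrt ?k) ^ 4"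
      using mom(3) by linarith
    then have "1 / 22 \<le> prob {\<omega> \<in> space M. B j \<omega> \<ge> (s * sqrt ?k) / 10}"
    proof (intro prob_ge_tenth_std)
      show "\<bar>B j \<omega>\<bar> \<le> ?k * L" if "\<omega> \<in> space M" for \<omega>
        unfolding B_def using sub[of j] bnd that by (intro abs_sum_le_card) blast
    qed (use k0 s mom(1,2) in \<open>simp_all add: power_mult_distrib\<close>)
    also have "\<dots> \<le> prob (B j -` {r..} \<inter> space M)"
    proof (rule finite_measure_mono)
      have "r \<le> s * sqrt ?k / 10"
        unfolding r_def using k s by (intro divide_right_mono mult_left_mono) auto
      then show "{\<omega> \<in> space M. B j \<omega> \<ge> (s * sqrt ?k) / 10} \<subseteq> B j -` {r..} \<inter> space M"
        by auto
    qed measurable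
    finally show ?thesis .
  qed
  have "(1 / 22) ^ m = (\<Prod>j<m. 1 / 22 :: real)" by simp
  also have "\<dots> \<le> (\<Prod>j<m. prob (B j -` {r..} \<inter> space M))"
    by (intro prod_mono conjI block) simp_all
  also have "\<dots> = prob (\<Inter>j\<in>{..<m}. B j -` {r..} \<inter> space M)"
    using m by (intro indep_varsD_finite[OF Bind, symmetric]) (auto simp: lessThan_empty_iff)
  also have "\<dots> \<le> prob {\<omega> \<in> space M. (\<Sum>i=1..n. Y i \<omega>) \<ge> s * sqrt (n * m / 2) / 10}"
  proof (rule finite_measure_mono)
    have tot: "(\<Sum>i=1..n. Y i \<omega>) = (\<Sum>j<m. B j \<omega>)" for \<omega>
      unfolding B_def K_def using m by (intro sum.group[symmetric]) auto
    have eq: "m * r = s * sqrt (n * m / 2) / 10"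
    proof -
      have "real m * sqrt (n / (2 * m)) = sqrt ((real m)\<^sup>2 * (n / (2 * m)))"
        by (simp only: real_sqrt_mult real_sqrt_abs abs_of_nat)
      also have "(real m)\<^sup>2 * (n / (2 * m)) = n * m / 2"
        using m by (simp add: power2_eq_square)
      finally show ?thesis by (simp add: r_def)
    qed
    have "\<omega> \<in> space M \<and> m * r \<le> (\<Sum>j<m. B j \<omega>)"
      if "\<omega> \<in> (\<Inter>j\<in>{..<m}. B j -` {r..} \<inter> space M)" for \<omega>
    proof -
      have "\<omega> \<in> B j -` {r..} \<inter> space M" if "j < m" for j
        using INT_D[OF \<open>\<omega> \<in> _\<close>, of j] that by simp
      then show ?thesis
        using sum_bounded_below[of "{..<m}" r "\<lambda>j. B j \<omega>"] m(1) by (auto simp: Suc_le_eq)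
    qed
    then show "(\<Inter>j\<in>{..<m}. B j -` {r..} \<inter> space M)
        \<subseteq> {\<omega> \<in> space M. (\<Sum>i=1..n. Y i \<omega>) \<ge> s * sqrt (n * m / 2) / 10}"
      unfolding tot eq[symmetric] by blast
    show "{\<omega> \<in> space M. (\<Sum>i=1..n. Y i \<omega>) \<ge> s * sqrt (n * m / 2) / 10} \<in> events"
      unfolding tot by measurable
  qed
  finally show ?thesis by (simp only: of_nat_mult)
qed

end

section \<open>Truncation of an i.i.d.\ sequence\<close>

text \<open>Values beyond the level become 0 instead of being clipped, and the inequality is strict:
  the square is then the integrand of \<open>trunc_second_moment\<close>, and changes occur only on
  the closed event counted by \<open>tail\<close>.\<close>

definition truncate_at :: "real \<Rightarrow> real \<Rightarrow> real" where
  "truncate_at L x = (if \<bar>x\<bar> < L then x else 0)"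

lemma truncate_at_measurable [measurable]: "truncate_at L \<in> borel_measurable borel"
  unfolding truncate_at_def by measurable

lemma abs_truncate_at_le: "L \<ge> 0 \<Longrightarrow> \<bar>truncate_at L x\<bar> \<le> L"
  by (simp add: truncate_at_def)

lemma exp_neg_quot_antimono:
  assumes "s \<le> t" "x \<ge> 0"
  shows "exp_neg_quot t x \<le> exp_neg_quot s x"
  using divide_right_mono[OF assms] by (simp add: exp_neg_quot_def)

locale iid_reals = prob_space M for M :: "'a measure" +
  fixes X :: "nat \<Rightarrow> 'a \<Rightarrow> real"
  assumes iid: "iid_sequence M X"
begin

definition trunc_mean :: "real \<Rightarrow> real" where
  "trunc_mean L = expectation (\<lambda>\<omega>. truncate_at L (X 1 \<omega>))"

definition trunc_third :: "real \<Rightarrow> real" where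
  "trunc_third L = expectation (\<lambda>\<omega>. \<bar>truncate_at L (X 1 \<omega>)\<bar> ^ 3)"

definition trunc_sum :: "real \<Rightarrow> nat \<Rightarrow> 'a \<Rightarrow> real" where
  "trunc_sum L n \<omega> = (\<Sum>i=1..n. truncate_at L (X i \<omega>))"

definition tail :: "real \<Rightarrow> real" where
  "tail r = prob {\<omega> \<in> space M. \<bar>X 1 \<omega>\<bar> \<ge> r}"

lemma indep: "indep_vars (\<lambda>_. borel) X {1..}"
  using iid unfolding iid_sequence_def by blast

lemma rv [measurable]: "i \<ge> 1 \<Longrightarrow> random_variable borel (X i)"
  using indep by (auto simp: indep_vars_def)

lemma rv1 [measurable]: "random_variable borel (X 1)" "random_variable borel (X (Suc 0))"
  using rv[of 1] by auto

lemma expectation_same: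
  fixes f :: "real \<Rightarrow> real"
  assumes i: "i \<ge> 1" and "f \<in> borel_measurable borel"
  shows "expectation (\<lambda>\<omega>. f (X i \<omega>)) = expectation (\<lambda>\<omega>. f (X 1 \<omega>))"
proof -
  have int: "integral\<^sup>L (distr M borel (X j)) f = expectation (\<lambda>\<omega>. f (X j \<omega>))" if "j \<ge> 1" for j
    by (rule integral_distr[OF rv[OF that] assms(2)])
  have "distr M borel (X i) = distr M borel (X 1)"
    using iid i unfolding iid_sequence_def by blast
  then show ?thesis
    using int[OF i] int[of 1] by simp
qed

lemma prob_tail_same:
  assumes "i \<ge> 1"
  shows "prob {\<omega> \<in> space M. \<bar>X i \<omega>\<bar> \<ge> r} = tail r"
proof -
  have dist: "measure (distr M borel (X j)) {x. \<bar>x\<bar> \<ge> r} = prob {\<omega> \<in> space M. \<bar>X j \<omega>\<bar> \<ge> r}"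
    if "j \<ge> 1" for j
  proof -
    have "measure (distr M borel (X j)) {x. \<bar>x\<bar> \<ge> r} = prob (X j -` {x. \<bar>x\<bar> \<ge> r} \<inter> space M)"
      by (rule measure_distr[OF rv[OF that]]) measurable
    also have "X j -` {x. \<bar>x\<bar> \<ge> r} \<inter> space M = {\<omega> \<in> space M. \<bar>X j \<omega>\<bar> \<ge> r}"
      by blast
    finally show ?thesis .
  qed
  have "distr M borel (X i) = distr M borel (X 1)"
    using iid assms unfolding iid_sequence_def by blast
  then show ?thesis
    using dist[OF assms] dist[of 1] by (simp add: tail_def)
qed

lemma partial_sum_rv [measurable]: "random_variable borel (partial_sum X n)"
  unfolding partial_sum_def[abs_def] by (intro borel_measurable_sum rv) auto

lemma trunc_rv: "i \<ge> 1 \<Longrightarrow> random_variable borel (\<lambda>\<omega>. truncate_at L (X i \<omega>))"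
  by measurable

lemma trunc_sum_rv [measurable]: "random_variable borel (trunc_sum L n)"
  unfolding trunc_sum_def[abs_def] by (intro borel_measurable_sum trunc_rv) auto

lemma trunc_indep: "indep_vars (\<lambda>_. borel) (\<lambda>i \<omega>. truncate_at L (X i \<omega>)) {1..n}"
  by (rule indep_vars_compose2[OF indep_vars_subset[OF indep]]) auto

lemma trunc_second_moment_eq:
  "trunc_second_moment M (X 1) L = expectation (\<lambda>\<omega>. (truncate_at L (X 1 \<omega>))\<^sup>2)"
  unfolding trunc_second_moment_def truncate_at_def
  by (intro Bochner_Integration.integral_cong) (auto simp: indicator_def)

lemma trunc_moments:
  assumes "i \<ge> 1"
  shows "expectation (\<lambda>\<omega>. truncate_at L (X i \<omega>)) = trunc_mean L"
    "expectation (\<lambda>\<omega>. (truncate_at L (X i \<omega>))\<^sup>2) = trunc_second_moment M (X 1) L"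
    "expectation (\<lambda>\<omega>. \<bar>truncate_at L (X i \<omega>)\<bar> ^ 3) = trunc_third L"
  unfolding trunc_mean_def trunc_second_moment_eq trunc_third_def
  using assms by (rule expectation_same[of i "\<lambda>x. truncate_at L x"]
      expectation_same[of i "\<lambda>x. (truncate_at L x)\<^sup>2"]
      expectation_same[of i "\<lambda>x. \<bar>truncate_at L x\<bar> ^ 3"], measurable)+

lemma tail_nonneg: "tail r \<ge> 0" by (simp add: tail_def)

lemma tail_antimono: "r \<le> s \<Longrightarrow> tail s \<le> tail r"
  unfolding tail_def by (intro finite_measure_mono) auto

section \<open>Passing between the sum and its truncation\<close>

lemma prob_truncation_differs: "prob {\<omega> \<in> space M. partial_sum X n \<omega> \<noteq> trunc_sum L n \<omega>} \<le> n * tail L"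
proof -
  have "prob {\<omega> \<in> space M. partial_sum X n \<omega> \<noteq> trunc_sum L n \<omega>}
      \<le> prob (\<Union>i\<in>{1..n}. {\<omega> \<in> space M. \<bar>X i \<omega>\<bar> \<ge> L})"
  proof (rule finite_measure_mono)
    have "\<exists>i\<in>{1..n}. \<bar>X i \<omega>\<bar> \<ge> L" if "partial_sum X n \<omega> \<noteq> trunc_sum L n \<omega>" for \<omega>
    proof (rule ccontr)
      assume "\<not> ?thesis"
      then have "partial_sum X n \<omega> = trunc_sum L n \<omega>"
        unfolding partial_sum_def trunc_sum_def truncate_at_def by (intro sum.cong) (simp_all add: not_le)
      with that show False by simp
    qed
    then show "{\<omega> \<in> space M. partial_sum X n \<omega> \<noteq> trunc_sum L n \<omega>}
      \<subseteq> (\<Union>i\<in>{1..n}. {\<omega> \<in> space M. \<bar>X i \<omega>\<bar> \<ge> L})" by blast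
    show "(\<Union>i\<in>{1..n}. {\<omega> \<in> space M. \<bar>X i \<omega>\<bar> \<ge> L}) \<in> events"
      by (intro sets.finite_UN) auto
  qed
  also have "\<dots> \<le> (\<Sum>i=1..n. prob {\<omega> \<in> space M. \<bar>X i \<omega>\<bar> \<ge> L})"
    by (intro measure_UNION_le) auto
  also have "\<dots> = n * tail L"
    by (simp add: prob_tail_same)
  finally show ?thesis .
qed

text \<open>One direction carries upper bounds to \<open>partial_sum\<close>, the other carries
  lower bounds for the truncated sum. Weighted by \<open>\<tau> n\<close>, the error is the term of
  condition (ii).\<close>

lemma prob_replace_trunc:
  assumes [measurable]: "Measurable.pred borel P"
  shows "prob {\<omega> \<in> space M. P (partial_sum X n \<omega>)}
      \<le> prob {\<omega> \<in> space M. P (trunc_sum L n \<omega>)} + n * tail L"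
    and "prob {\<omega> \<in> space M. P (trunc_sum L n \<omega>)}
      \<le> prob {\<omega> \<in> space M. P (partial_sum X n \<omega>)} + n * tail L"
proof -
  let ?D = "{\<omega> \<in> space M. partial_sum X n \<omega> \<noteq> trunc_sum L n \<omega>}"
  have "prob {\<omega> \<in> space M. P (partial_sum X n \<omega>)} \<le> prob ({\<omega> \<in> space M. P (trunc_sum L n \<omega>)} \<union> ?D)"
    by (intro finite_measure_mono) auto
  also have "\<dots> \<le> prob {\<omega> \<in> space M. P (trunc_sum L n \<omega>)} + prob ?D"
    by (intro measure_subadditive) auto
  finally show "prob {\<omega> \<in> space M. P (partial_sum X n \<omega>)}
      \<le> prob {\<omega> \<in> space M. P (trunc_sum L n \<omega>)} + n * tail L"
    using prob_truncation_differs[of n L] by linarith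
  have "prob {\<omega> \<in> space M. P (trunc_sum L n \<omega>)} \<le> prob ({\<omega> \<in> space M. P (partial_sum X n \<omega>)} \<union> ?D)"
    by (intro finite_measure_mono) auto
  also have "\<dots> \<le> prob {\<omega> \<in> space M. P (partial_sum X n \<omega>)} + prob ?D"
    by (intro measure_subadditive) auto
  finally show "prob {\<omega> \<in> space M. P (trunc_sum L n \<omega>)}
      \<le> prob {\<omega> \<in> space M. P (partial_sum X n \<omega>)} + n * tail L"
    using prob_truncation_differs[of n L] by linarith
qed

text \<open>With this \<open>\<delta>\<close> the requirement
  \<open>4 * \<theta> * L \<le> t\<close> of \<open>fuk_nagaev\<close> holds with equality. The
  exponent is weakened from \<open>\<epsilon>\<^sup>2 / 2\<close> to \<open>\<delta>\<^sup>2\<close>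
  because condition (iii) has the same constant in the exponent and in the truncation level.\<close>

lemma trunc_sum_upper:
  assumes \<theta>: "\<theta> \<ge> 1" and \<epsilon>: "\<epsilon> > 0" and a: "a > 0" and \<delta>: "\<delta> = \<epsilon> / (4 * \<theta>)"
  shows "prob {\<omega> \<in> space M. \<bar>trunc_sum (\<delta> * a) n \<omega> - n * trunc_mean (\<delta> * a)\<bar> \<ge> \<epsilon> * a}
    \<le> 2 * exp (288 * \<theta> ^ 3) * (exp_neg_quot (\<delta>\<^sup>2 * a\<^sup>2) (n * trunc_second_moment M (X 1) (\<delta> * a))
       + (1 / \<epsilon> ^ 3) powr \<theta> * (n * trunc_third (\<delta> * a) / a ^ 3) powr \<theta>)"
proof -
  let ?L = "\<delta> * a" and ?t = "\<epsilon> * a"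
  have L: "?L \<ge> 0" "4 * \<theta> * ?L \<le> ?t" using assms by auto
  have "prob {\<omega> \<in> space M. \<bar>(\<Sum>i\<in>{1..n}. truncate_at ?L (X i \<omega>)) - card {1..n} * trunc_mean ?L\<bar> \<ge> ?t}
    \<le> 2 * exp (288 * \<theta> ^ 3) * (exp_neg_quot (?t\<^sup>2 / 2) (card {1..n} * trunc_second_moment M (X 1) ?L)
       + (card {1..n} * trunc_third ?L / ?t ^ 3) powr \<theta>)"
    by (rule fuk_nagaev[OF _ trunc_indep abs_truncate_at_le[OF L(1)] _ _ _ \<theta> _ L(2)])
      (use assms in \<open>auto simp: trunc_moments\<close>)
  moreover have "(n * trunc_third ?L / ?t ^ 3) powr \<theta>
      = (1 / \<epsilon> ^ 3) powr \<theta> * (n * trunc_third ?L / a ^ 3) powr \<theta>"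
    using \<epsilon> a by (subst powr_mult[symmetric])
      (auto simp: trunc_third_def power_mult_distrib intro!: integral_nonneg_AE)
  moreover have "exp_neg_quot (?t\<^sup>2 / 2) (n * trunc_second_moment M (X 1) ?L)
      \<le> exp_neg_quot (\<delta>\<^sup>2 * a\<^sup>2) (n * trunc_second_moment M (X 1) ?L)"
  proof -
    have "\<delta> \<le> \<epsilon> / 4" using \<theta> \<epsilon> by (simp add: \<delta> field_simps)
    then have "\<delta>\<^sup>2 \<le> (\<epsilon> / 4)\<^sup>2" using \<theta> \<epsilon> \<delta> by (intro power_mono) auto
    also have "\<dots> \<le> \<epsilon>\<^sup>2 / 2" using \<epsilon> by (simp add: power2_eq_square)
    finally have "\<delta>\<^sup>2 * a\<^sup>2 \<le> \<epsilon>\<^sup>2 / 2 * a\<^sup>2" by (rule mult_right_mono) simp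
    moreover have "trunc_second_moment M (X 1) ?L \<ge> 0"
      unfolding trunc_second_moment_eq by (intro integral_nonneg_AE) auto
    ultimately show ?thesis
      by (intro exp_neg_quot_antimono) (simp_all add: power_mult_distrib)
  qed
  ultimately show ?thesis
    unfolding trunc_sum_def by (auto intro: order_trans)
qed

end

section \<open>A lower bound for truncated sums\<close>

lemma diff_power4_le:
  fixes x y :: real
  shows "(x - y) ^ 4 \<le> 8 * x ^ 4 + 8 * y ^ 4"
proof -
  have "(x - y)\<^sup>2 \<le> 2 * (x\<^sup>2 + y\<^sup>2)"
    using zero_le_power2[of "x + y"] by (simp add: power2_eq_square algebra_simps)
  then have "((x - y)\<^sup>2)\<^sup>2 \<le> (2 * (x\<^sup>2 + y\<^sup>2))\<^sup>2"
    by (intro power_mono) auto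
  also have "\<dots> \<le> 8 * (x\<^sup>2)\<^sup>2 + 8 * (y\<^sup>2)\<^sup>2"
    using zero_le_power2[of "x\<^sup>2 - y\<^sup>2"] by (simp add: power2_eq_square algebra_simps)
  finally show ?thesis by simp
qed

text \<open>Since \<open>(5 / 2) ^ 4 > 22\<close>. The 4 later cancels against the 4 in the number
  \<open>\<epsilon>\<^sup>2 / (4 * v)\<close> of blocks.\<close>

lemma exp_neg_four_le: "exp (- (4 * real m)) \<le> (1 / 22) ^ m"
proof -
  have "(5 / 2) ^ 4 \<le> exp (1::real) ^ 4"
    using exp_lower_Taylor_quadratic[of "1::real"] by (intro power_mono) auto
  then have "22 \<le> exp (4::real)"
    by (simp add: power_divide flip: exp_of_nat_mult)
  then have "exp (- 4 :: real) \<le> 1 / 22"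
    by (simp add: exp_minus field_simps)
  then have "exp (- 4 :: real) ^ m \<le> (1 / 22) ^ m"
    by (intro power_mono) auto
  then show ?thesis by (simp add: mult.commute flip: exp_of_nat_mult)
qed

lemma min_one_cube_le_square:
  fixes v :: real
  assumes "v \<ge> 0"
  shows "min 1 v ^ 3 \<le> v\<^sup>2"
proof (cases "v \<le> 1")
  case True
  then have "v\<^sup>2 * v \<le> v\<^sup>2 * 1" using assms by (intro mult_left_mono) auto
  then show ?thesis using True by (simp add: power2_eq_square power3_eq_cube)
next
  case False
  then show ?thesis by (simp add: one_le_power)
qed

context iid_reals
begin

definition centred :: "real \<Rightarrow> nat \<Rightarrow> 'a \<Rightarrow> real" where
  "centred L i \<omega> = truncate_at L (X i \<omega>) - trunc_mean L"

definition centred_fourth :: "real \<Rightarrow> real" where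
  "centred_fourth L = expectation (\<lambda>\<omega>. centred L 1 \<omega> ^ 4)"

lemma trunc_integrable:
  assumes "L \<ge> 0"
  shows "integrable M (\<lambda>\<omega>. truncate_at L (X 1 \<omega>))"
    "integrable M (\<lambda>\<omega>. truncate_at L (X 1 \<omega>) ^ k)"
    "integrable M (\<lambda>\<omega>. \<bar>truncate_at L (X 1 \<omega>)\<bar> ^ k)"
  by (rule integrable_powers[OF trunc_rv[OF order_refl] abs_truncate_at_le[OF assms]])+

lemma abs_trunc_mean_le:
  assumes "L \<ge> 0"
  shows "\<bar>trunc_mean L\<bar> \<le> L"
proof -
  have "\<bar>trunc_mean L\<bar> \<le> expectation (\<lambda>\<omega>. \<bar>truncate_at L (X 1 \<omega>)\<bar>)"
    unfolding trunc_mean_def by (rule integral_abs_bound)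
  also have "\<dots> \<le> expectation (\<lambda>_. L)"
    using trunc_integrable(3)[OF assms, of 1] abs_truncate_at_le[OF assms]
    by (intro integral_mono) auto
  finally show ?thesis by (simp add: prob_space)
qed

lemma abs_centred_le: "L \<ge> 0 \<Longrightarrow> \<bar>centred L i \<omega>\<bar> \<le> 2 * L"
  using abs_truncate_at_le[of L "X i \<omega>"] abs_trunc_mean_le[of L] by (simp add: centred_def)

lemma centred_indep: "indep_vars (\<lambda>_. borel) (centred L) {1..n}"
  unfolding centred_def[abs_def]
  by (rule indep_vars_compose2[OF indep_vars_subset[OF indep]]) auto

lemma centred_moments:
  assumes L: "L \<ge> 0" and i: "i \<ge> 1"
  shows "expectation (centred L i) = 0"
    "expectation (\<lambda>\<omega>. (centred L i \<omega>)\<^sup>2) = trunc_second_moment M (X 1) L - (trunc_mean L)\<^sup>2"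
    "expectation (\<lambda>\<omega>. centred L i \<omega> ^ 4) = centred_fourth L"
proof -
  note int = trunc_integrable[OF L]
  have "expectation (centred L i) = expectation (\<lambda>\<omega>. centred L 1 \<omega>)"
    unfolding centred_def[abs_def] by (rule expectation_same[OF i]) measurable
  then show "expectation (centred L i) = 0"
    using int(1) by (simp add: centred_def trunc_mean_def[symmetric, simplified] prob_space)
  have "expectation (\<lambda>\<omega>. (centred L i \<omega>)\<^sup>2) = expectation (\<lambda>\<omega>. (centred L 1 \<omega>)\<^sup>2)"
    unfolding centred_def[abs_def] by (rule expectation_same[OF i]) measurable
  also have "\<dots> = variance (\<lambda>\<omega>. truncate_at L (X 1 \<omega>))"
    by (simp add: centred_def trunc_mean_def)
  also have "\<dots> = trunc_second_moment M (X 1) L - (trunc_mean L)\<^sup>2"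
    unfolding trunc_second_moment_eq trunc_mean_def by (rule variance_eq[OF int(1,2)])
  finally show "expectation (\<lambda>\<omega>. (centred L i \<omega>)\<^sup>2) = trunc_second_moment M (X 1) L - (trunc_mean L)\<^sup>2" .
  show "expectation (\<lambda>\<omega>. centred L i \<omega> ^ 4) = centred_fourth L"
    unfolding centred_fourth_def centred_def[abs_def] by (rule expectation_same[OF i]) measurable
qed

lemma sum_centred: "(\<Sum>i=1..n. centred L i \<omega>) = trunc_sum L n \<omega> - n * trunc_mean L"
  by (simp add: centred_def trunc_sum_def sum_subtractf)

lemma trunc_third_ge:
  assumes "L \<ge> 0"
  shows "sqrt (trunc_second_moment M (X 1) L) ^ 3 \<le> trunc_third L"
  unfolding trunc_second_moment_eq trunc_third_def
  by (rule sqrt_second_moment_cube_le_third[OF trunc_rv[OF order_refl] abs_truncate_at_le[OF assms]])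

text \<open>The truncation level turns a fourth moment into a third one:
  \<open>Y ^ 4 \<le> L * \<bar>Y\<bar> ^ 3\<close>. Centring costs a constant factor, as the fourth
  power of the mean is at most \<open>T\<^sup>2 / 4\<close>, and \<open>T\<^sup>2\<close> is at most
  the fourth moment (integrate \<open>(Y\<^sup>2 - T)\<^sup>2 \<ge> 0\<close>).\<close>

lemma centred_fourth_le:
  assumes L: "L \<ge> 0" and mean: "(trunc_mean L)\<^sup>2 \<le> trunc_second_moment M (X 1) L / 2"
  shows "centred_fourth L \<le> 16 * L * trunc_third L"
proof -
  let ?Y = "\<lambda>\<omega>. truncate_at L (X 1 \<omega>)" and ?T = "trunc_second_moment M (X 1) L"
  note int = trunc_integrable[OF L]
  have T0: "?T \<ge> 0" unfolding trunc_second_moment_eq by (intro integral_nonneg_AE) auto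
  have "expectation (\<lambda>\<omega>. 2 * ?T * (?Y \<omega>)\<^sup>2 - ?T\<^sup>2) \<le> expectation (\<lambda>\<omega>. ?Y \<omega> ^ 4)"
  proof (rule integral_mono)
    fix \<omega>
    show "2 * ?T * (?Y \<omega>)\<^sup>2 - ?T\<^sup>2 \<le> ?Y \<omega> ^ 4"
      using zero_le_power2[of "(?Y \<omega>)\<^sup>2 - ?T"]
      by (simp add: power2_eq_square power4_eq_xxxx algebra_simps)
  qed (use int in auto)
  also have "expectation (\<lambda>\<omega>. 2 * ?T * (?Y \<omega>)\<^sup>2 - ?T\<^sup>2) = 2 * ?T * ?T - ?T\<^sup>2"
    unfolding trunc_second_moment_eq using int(2)[of 2] by (simp add: prob_space)
  finally have T4: "?T\<^sup>2 \<le> expectation (\<lambda>\<omega>. ?Y \<omega> ^ 4)"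
    by (simp add: power2_eq_square)
  have "((trunc_mean L)\<^sup>2)\<^sup>2 \<le> (?T / 2)\<^sup>2"
    using mean by (intro power_mono) auto
  then have m4: "trunc_mean L ^ 4 \<le> ?T\<^sup>2 / 4"
    by (simp add: power_divide)
  have "centred_fourth L \<le> expectation (\<lambda>\<omega>. 8 * ?Y \<omega> ^ 4 + 8 * trunc_mean L ^ 4)"
    unfolding centred_fourth_def
  proof (rule integral_mono)
    show "integrable M (\<lambda>\<omega>. centred L 1 \<omega> ^ 4)"
      by (rule integrable_powers(2)[OF _ abs_centred_le[OF L]]) (simp add: centred_def)
  qed (use int diff_power4_le in \<open>auto simp: centred_def\<close>)
  also have "\<dots> = 8 * expectation (\<lambda>\<omega>. ?Y \<omega> ^ 4) + 8 * trunc_mean L ^ 4"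
    using int by (simp add: prob_space)
  also have "\<dots> \<le> 16 * expectation (\<lambda>\<omega>. ?Y \<omega> ^ 4)"
    using T4 m4 zero_le_power2[of ?T] by linarith
  also have "expectation (\<lambda>\<omega>. ?Y \<omega> ^ 4) \<le> expectation (\<lambda>\<omega>. L * \<bar>?Y \<omega>\<bar> ^ 3)"
  proof (rule integral_mono)
    fix \<omega>
    have "?Y \<omega> ^ 4 = \<bar>?Y \<omega>\<bar> * \<bar>?Y \<omega>\<bar> ^ 3"
      by (simp add: power4_eq_xxxx power3_eq_cube abs_if)
    also have "\<dots> \<le> L * \<bar>?Y \<omega>\<bar> ^ 3"
      using abs_truncate_at_le[OF L] by (intro mult_right_mono) auto
    finally show "?Y \<omega> ^ 4 \<le> L * \<bar>?Y \<omega>\<bar> ^ 3" .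
  qed (use int in auto)
  finally show ?thesis by (simp add: trunc_third_def)
qed

text \<open>Here the drift alone suffices. The variance of the sum is at most
  \<open>n * \<mu>\<^sup>2\<close>, so by Chebyshev it deviates from \<open>n * \<mu>\<close> by
  \<open>c\<close>, half the modulus of that value, with probability at most \<open>4 / n\<close>;
  this is where \<open>n \<ge> 8\<close> comes from. The factor 3 ensures
  \<open>b \<le> c\<close>.\<close>

lemma trunc_sum_large_if_mean_large:
  assumes L: "L \<ge> 0" and n: "n \<ge> 8" and T: "trunc_second_moment M (X 1) L > 0"
    and mean: "(trunc_mean L)\<^sup>2 \<ge> trunc_second_moment M (X 1) L / 2"
    and b: "3 * b \<le> n * sqrt (trunc_second_moment M (X 1) L)"
  shows "1 / 2 \<le> prob {\<omega> \<in> space M. \<bar>trunc_sum L n \<omega>\<bar> \<ge> b}"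
proof -
  let ?T = "trunc_second_moment M (X 1) L" and ?\<mu> = "trunc_mean L"
  let ?Z = "\<lambda>\<omega>. \<Sum>i=1..n. centred L i \<omega>"
  define c where "c = \<bar>n * ?\<mu>\<bar> / 2"
  have n0: "real n > 0" using n by simp
  have \<mu>0: "?\<mu>\<^sup>2 > 0" using mean T by linarith
  then have c0: "c > 0" using n0 by (simp add: c_def)
  have bc: "b \<le> c"
  proof (cases "b \<le> 0")
    case False
    have "(3 * b)\<^sup>2 \<le> (n * sqrt ?T)\<^sup>2" using b False by (intro power_mono) auto
    also have "\<dots> = n\<^sup>2 * ?T" using T by (simp add: power_mult_distrib)
    also have "\<dots> \<le> n\<^sup>2 * (2 * ?\<mu>\<^sup>2)" using mean by (intro mult_left_mono) auto
    also have "\<dots> = 8 * c\<^sup>2" by (simp add: c_def power_mult_distrib power_divide)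
    finally have "9 * b\<^sup>2 \<le> 8 * c\<^sup>2" by (simp add: power_mult_distrib)
    then have "b\<^sup>2 \<le> c\<^sup>2" using zero_le_power2[of c] by linarith
    then show ?thesis using c0 by (rule power2_le_imp_le[OF _ less_imp_le])
  qed (use c0 in simp)
  have rvZ: "random_variable borel ?Z"
    unfolding sum_centred by measurable
  have bZ: "\<bar>?Z \<omega>\<bar> \<le> n * (2 * L)" for \<omega>
    using abs_sum_le_card[of "{1..n}" "centred L" \<omega> "2 * L"] abs_centred_le[OF L] by auto
  have s2: "sqrt (?T - ?\<mu>\<^sup>2) ^ 2 = ?T - ?\<mu>\<^sup>2"
  proof -
    have "0 \<le> expectation (\<lambda>\<omega>. (centred L 1 \<omega>)\<^sup>2)" by (intro integral_nonneg_AE) auto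
    also note centred_moments(2)[OF L order_refl]
    finally show ?thesis by simp
  qed
  have Zm: "expectation (centred L i) = 0"
    "expectation (\<lambda>\<omega>. (centred L i \<omega>)\<^sup>2) = (sqrt (?T - ?\<mu>\<^sup>2))\<^sup>2"
    "expectation (\<lambda>\<omega>. centred L i \<omega> ^ 4) = centred_fourth L" if "i \<in> {1..n}" for i
    unfolding s2 using that by (intro centred_moments[OF L]; simp)+
  have mom1: "expectation ?Z = 0"
    by (rule sum_centred_moments(1)[OF finite_atLeastAtMost centred_indep abs_centred_le[OF L] Zm])
  have "expectation (\<lambda>\<omega>. (?Z \<omega>)\<^sup>2) = card {1..n} * (sqrt (?T - ?\<mu>\<^sup>2))\<^sup>2"
    by (rule sum_centred_moments(2)[OF finite_atLeastAtMost centred_indep abs_centred_le[OF L] Zm])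
  then have mom2: "expectation (\<lambda>\<omega>. (?Z \<omega>)\<^sup>2) = n * (?T - ?\<mu>\<^sup>2)"
    unfolding s2 by (simp only: card_atLeastAtMost diff_Suc_1)
  have "prob {\<omega> \<in> space M. \<bar>?Z \<omega>\<bar> \<ge> c} \<le> n * (?T - ?\<mu>\<^sup>2) / c\<^sup>2"
    using Chebyshev_inequality[OF rvZ integrable_powers(2)[OF rvZ bZ] c0]
    unfolding mom1 by (simp only: mom2 diff_zero)
  also have "\<dots> \<le> n * ?\<mu>\<^sup>2 / c\<^sup>2"
    using mean by (intro divide_right_mono mult_left_mono) auto
  also have "\<dots> = 4 / n"
  proof -
    have "c\<^sup>2 = n * (n * ?\<mu>\<^sup>2) / 4"
      by (simp add: c_def power_mult_distrib power_divide power2_eq_square[of "real n"])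
    then show ?thesis using c0 n0 by (simp add: field_simps)
  qed
  also have "\<dots> \<le> 1 / 2" using n by (simp add: field_simps)
  finally have "1 / 2 \<le> 1 - prob {\<omega> \<in> space M. \<bar>?Z \<omega>\<bar> \<ge> c}" by simp
  also have "\<dots> = prob {\<omega> \<in> space M. \<not> \<bar>?Z \<omega>\<bar> \<ge> c}"
    unfolding sum_centred by (intro prob_neg[symmetric]) measurable
  also have "\<dots> \<le> prob {\<omega> \<in> space M. \<bar>trunc_sum L n \<omega>\<bar> \<ge> b}"
    unfolding sum_centred
  proof (rule finite_measure_mono)
    have "b \<le> \<bar>trunc_sum L n \<omega>\<bar>" if "\<not> c \<le> \<bar>trunc_sum L n \<omega> - n * ?\<mu>\<bar>" for \<omega>
      using bc that unfolding c_def by linarith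
    then show "{\<omega> \<in> space M. \<not> c \<le> \<bar>trunc_sum L n \<omega> - n * ?\<mu>\<bar>}
        \<subseteq> {\<omega> \<in> space M. b \<le> \<bar>trunc_sum L n \<omega>\<bar>}" by blast
  qed measurable
  finally show ?thesis .
qed

text \<open>The bound on the mean leaves a variance of at least \<open>T / 2\<close>. Then
  \<open>128 = 16 * 2 * 4\<close> is what \<open>centred_fourth_le\<close> needs to meet the fourth
  moment hypothesis of \<open>sum_exceeds_by_blocks\<close>, and
  \<open>400 = 10\<^sup>2 * 2 * 2\<close> makes its deviation reach \<open>b\<close>.\<close>

lemma trunc_sum_large_by_blocks:
  assumes L: "L \<ge> 0" and T: "trunc_second_moment M (X 1) L > 0"
    and mean: "(trunc_mean L)\<^sup>2 < trunc_second_moment M (X 1) L / 2"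
    and m: "1 \<le> m" "m \<le> n"
    and third: "128 * L * m * trunc_third L \<le> n * (trunc_second_moment M (X 1) L)\<^sup>2"
    and b: "b \<ge> 0" "400 * b\<^sup>2 \<le> n * m * trunc_second_moment M (X 1) L"
  shows "(1 / 22) ^ m \<le> prob {\<omega> \<in> space M. \<bar>trunc_sum L n \<omega>\<bar> \<ge> b}"
proof -
  let ?T = "trunc_second_moment M (X 1) L" and ?\<mu> = "trunc_mean L"
  let ?\<kappa> = "centred_fourth L"
  define s where "s = sqrt (?T - ?\<mu>\<^sup>2)"
  have s: "s > 0" "s\<^sup>2 = ?T - ?\<mu>\<^sup>2" using mean T by (auto simp: s_def)
  have sT: "?T / 2 \<le> s\<^sup>2" using mean s(2) by simp
  have "(?T / 2)\<^sup>2 \<le> (s\<^sup>2)\<^sup>2" using sT T by (intro power_mono) auto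
  then have s4: "?T\<^sup>2 / 4 \<le> s ^ 4" by (simp add: power_divide)
  have "?\<kappa> \<le> 16 * L * trunc_third L"
    using mean by (intro centred_fourth_le L) auto
  also have "\<dots> \<le> real n / (2 * real m) * (?T\<^sup>2 / 4)"
    using third m by (simp add: field_simps)
  also have "\<dots> \<le> real n / (2 * real m) * s ^ 4"
    using s4 by (intro mult_left_mono) auto
  finally have \<kappa>: "?\<kappa> \<le> real n / (2 * real m) * s ^ 4" .
  have "b * 10 \<le> s * sqrt (real n * real m / 2)"
  proof (rule power2_le_imp_le)
    have "(b * 10)\<^sup>2 \<le> ?T / 2 * (real n * real m / 2)" using b by (simp add: power_mult_distrib mult_ac)
    also have "\<dots> \<le> s\<^sup>2 * (real n * real m / 2)" using sT by (intro mult_right_mono) auto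
    finally show "(b * 10)\<^sup>2 \<le> (s * sqrt (real n * real m / 2))\<^sup>2" by (simp add: power_mult_distrib)
  qed (use s in simp)
  then have b10: "b \<le> s * sqrt (real n * real m / 2) / 10" by simp
  have mom: "i \<in> {1..n} \<Longrightarrow> expectation (centred L i) = 0"
    "i \<in> {1..n} \<Longrightarrow> expectation (\<lambda>\<omega>. (centred L i \<omega>)\<^sup>2) = s\<^sup>2"
    "i \<in> {1..n} \<Longrightarrow> expectation (\<lambda>\<omega>. centred L i \<omega> ^ 4) = ?\<kappa>" for i
    using centred_moments[OF L, of i] s(2) by auto
  show ?thesis
  \<comment> \<open>The deviation is taken in the direction of the mean, so that adding
    \<open>n * ?\<mu>\<close> back can only increase the modulus.\<close>
  proof (cases "?\<mu> \<ge> 0")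
    case True
    have "(1 / 22) ^ m \<le> prob {\<omega> \<in> space M. (\<Sum>i=1..n. centred L i \<omega>) \<ge> s * sqrt (real n * real m / 2) / 10}"
      by (rule sum_exceeds_by_blocks[OF centred_indep abs_centred_le[OF L] mom s(1) m \<kappa>])
    also have "\<dots> \<le> prob {\<omega> \<in> space M. \<bar>trunc_sum L n \<omega>\<bar> \<ge> b}"
    proof (rule finite_measure_mono)
      have "b \<le> \<bar>trunc_sum L n \<omega>\<bar>"
        if "s * sqrt (real n * real m / 2) / 10 \<le> (\<Sum>i=1..n. centred L i \<omega>)" for \<omega>
        using that b10 mult_nonneg_nonneg[OF of_nat_0_le_iff True, of n] unfolding sum_centred by linarith
      then show "{\<omega> \<in> space M. s * sqrt (real n * real m / 2) / 10 \<le> (\<Sum>i=1..n. centred L i \<omega>)}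
          \<subseteq> {\<omega> \<in> space M. b \<le> \<bar>trunc_sum L n \<omega>\<bar>}" by blast
    qed measurable
    finally show ?thesis .
  next
    case False
    have ind: "indep_vars (\<lambda>_. borel) (\<lambda>i \<omega>. - centred L i \<omega>) {1..n}"
      by (rule indep_vars_compose2[OF centred_indep]) auto
    have "(1 / 22) ^ m \<le> prob {\<omega> \<in> space M. (\<Sum>i=1..n. - centred L i \<omega>) \<ge> s * sqrt (real n * real m / 2) / 10}"
      by (rule sum_exceeds_by_blocks[OF ind _ _ _ _ s(1) m \<kappa>, of "2 * L"])
        (use mom abs_centred_le[OF L] in auto)
    also have "\<dots> \<le> prob {\<omega> \<in> space M. \<bar>trunc_sum L n \<omega>\<bar> \<ge> b}"
    proof (rule finite_measure_mono)
      have "n * ?\<mu> \<le> 0" using False by (simp add: mult_nonneg_nonpos)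
      then have "b \<le> \<bar>trunc_sum L n \<omega>\<bar>"
        if "s * sqrt (real n * real m / 2) / 10 \<le> (\<Sum>i=1..n. - centred L i \<omega>)" for \<omega>
        using that b10 unfolding sum_negf sum_centred by linarith
      then show "{\<omega> \<in> space M. s * sqrt (real n * real m / 2) / 10 \<le> (\<Sum>i=1..n. - centred L i \<omega>)}
          \<subseteq> {\<omega> \<in> space M. b \<le> \<bar>trunc_sum L n \<omega>\<bar>}" by blast
    qed measurable
    finally show ?thesis .
  qed
qed

lemma trunc_second_moment_nonneg: "trunc_second_moment M (X 1) L \<ge> 0"
  unfolding trunc_second_moment_eq by (intro integral_nonneg_AE) auto

lemma trunc_third_nonneg: "trunc_third L \<ge> 0"
  unfolding trunc_third_def by (intro integral_nonneg_AE) auto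

text \<open>
  There may be more blocks than summands, or the fourth moment may be too large for the blocks to behave
  like Gaussian variables; both make the third moment large compared with the variance.
\<close>

lemma trunc_sum_lower_or_third_large:
  fixes \<epsilon> a L T u v :: real and n :: nat
  defines "L \<equiv> \<epsilon> * a"
  defines "T \<equiv> trunc_second_moment M (X 1) L"
  defines "v \<equiv> n * T / a\<^sup>2" and "u \<equiv> n * trunc_third L / a ^ 3"
  assumes \<epsilon>: "\<epsilon> > 0" and a: "a > 0" and n: "n \<ge> 8" and T: "T > 0"
  shows "min 1 v ^ 3 \<le> 128 * \<epsilon> * (1 + \<epsilon>\<^sup>2 / 4) * u \<or>
    exp (- 4) * exp (- (\<epsilon>\<^sup>2 / v)) \<le> prob {\<omega> \<in> space M. \<bar>trunc_sum L n \<omega>\<bar> \<ge> \<epsilon> / 40 * a}"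
proof -
  define r where "r = sqrt T"
  have r: "r > 0" "T = r\<^sup>2" using T by (auto simp: r_def)
  have L: "L \<ge> 0" using \<epsilon> a by (simp add: L_def)
  have \<beta>: "r ^ 3 \<le> trunc_third L"
    unfolding r_def T_def by (rule trunc_third_ge[OF L])
  have n0: "real n > 0" using n by simp
  have v0: "v > 0" using T a n0 by (simp add: v_def)
  have u0: "u \<ge> 0" using a trunc_third_nonneg[of L] by (simp add: u_def)
  \<comment> \<open>About \<open>x\<close> blocks are needed for the total to reach
    \<open>\<epsilon> / 40 * a\<close>: indeed
    \<open>400 * (\<epsilon> / 40 * a)\<^sup>2 = x * (v * a\<^sup>2)\<close>, and
    \<open>v * a\<^sup>2 = n * T\<close>.\<close>
  define x where "x = \<epsilon>\<^sup>2 / (4 * v)"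
  define m where "m = nat \<lceil>x\<rceil>"
  have x0: "x > 0" using \<epsilon> v0 by (simp add: x_def)
  have m1: "1 \<le> m" using x0 by (simp add: m_def Suc_le_eq)
  have mx: "x \<le> m" "m \<le> 1 + x"
    using x0 unfolding m_def by linarith+
  have vx: "4 * v * x = \<epsilon>\<^sup>2" using v0 by (simp add: x_def)
  have va: "v * a\<^sup>2 = n * r\<^sup>2" using a r by (simp add: v_def)
  show ?thesis
  proof (cases "m \<le> n")
    case False
    \<comment> \<open>More blocks than summands: this forces
      \<open>2 * n * r \<le> \<epsilon> * a\<close>. Together with
      \<open>r ^ 3 \<le> trunc_third L\<close> it bounds \<open>v\<^sup>2\<close> by a multiple of
      \<open>u\<close>.\<close>
    then have "n < x" unfolding m_def using x0 by linarith
    then have "4 * v * n < \<epsilon>\<^sup>2" using v0 vx by (metis mult_less_cancel_left_pos zero_less_mult_iff zero_less_numeral)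
    then have "4 * (v * a\<^sup>2) * n < \<epsilon>\<^sup>2 * a\<^sup>2"
      using a mult_strict_right_mono[of "4 * v * n" "\<epsilon>\<^sup>2" "a\<^sup>2"] by (simp add: mult_ac)
    then have "(2 * n * r)\<^sup>2 < (\<epsilon> * a)\<^sup>2"
      unfolding va by (simp add: power_mult_distrib power2_eq_square mult_ac)
    then have nr: "2 * n * r \<le> \<epsilon> * a"
      using \<epsilon> a by (intro less_imp_le) (rule power2_less_imp_less, auto)
    have "v\<^sup>2 * a ^ 4 = (v * a\<^sup>2)\<^sup>2"
      by (simp add: power_mult_distrib)
    also have "\<dots> = n * r ^ 3 * (n * r)"
      unfolding va by (simp add: power2_eq_square power3_eq_cube)
    also have "\<dots> \<le> n * trunc_third L * (\<epsilon> * a / 2)"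
      using \<beta> nr r trunc_third_nonneg[of L] by (intro mult_mono mult_left_mono) auto
    also have "\<dots> = u * \<epsilon> / 2 * a ^ 4"
      using a by (simp add: u_def power4_eq_xxxx power3_eq_cube)
    finally have "v\<^sup>2 \<le> u * \<epsilon> / 2"
      using a by simp
    also have "\<dots> \<le> u * (128 * \<epsilon> * (1 + \<epsilon>\<^sup>2 / 4))"
    proof -
      have "\<epsilon> * (1 / 2) \<le> \<epsilon> * (128 * (1 + \<epsilon>\<^sup>2 / 4))"
        using \<epsilon> by (intro mult_left_mono) auto
      then have "u * (\<epsilon> * (1 / 2)) \<le> u * (\<epsilon> * (128 * (1 + \<epsilon>\<^sup>2 / 4)))"
        by (rule mult_left_mono[OF _ u0])
      then show ?thesis by (simp add: mult_ac)
    qed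
    finally show ?thesis
      using min_one_cube_le_square[of v] v0 by (simp add: mult_ac)
  next
    case True
    have xn: "x \<le> n" using mx True by linarith
    show ?thesis
    proof (cases "(trunc_mean L)\<^sup>2 \<ge> T / 2")
      case mean: True
      have "\<epsilon>\<^sup>2 \<le> 4 * v * n"
        unfolding vx[symmetric] using xn v0 by (intro mult_left_mono) auto
      then have "\<epsilon>\<^sup>2 * a\<^sup>2 \<le> 4 * v * n * a\<^sup>2"
        by (rule mult_right_mono) simp
      also have "\<dots> = 4 * n * (v * a\<^sup>2)"
        by simp
      also have "\<dots> = (2 * n * r)\<^sup>2"
        unfolding va by (simp add: power_mult_distrib power2_eq_square)
      finally have "(\<epsilon> * a)\<^sup>2 \<le> (2 * n * r)\<^sup>2"
        by (simp add: power_mult_distrib)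
      then have "\<epsilon> * a \<le> 2 * n * r"
        by (rule power2_le_imp_le) (use r in simp)
      then have "3 * (\<epsilon> / 40 * a) \<le> n * r"
        using mult_pos_pos[OF n0 r(1)] by simp
      then have "1 / 2 \<le> prob {\<omega> \<in> space M. \<bar>trunc_sum L n \<omega>\<bar> \<ge> \<epsilon> / 40 * a}"
        using trunc_sum_large_if_mean_large[OF L n] T mean unfolding T_def r_def by blast
      moreover have "exp (- 4) * exp (- (\<epsilon>\<^sup>2 / v)) \<le> 1 / 22 * 1"
        using exp_neg_four_le[of 1] v0 by (intro mult_mono) auto
      ultimately show ?thesis by linarith
    next
      case mean: False
      show ?thesis
      proof (cases "128 * L * m * trunc_third L \<le> n * T\<^sup>2")
        case third: True
        have "400 * (\<epsilon> / 40 * a)\<^sup>2 = \<epsilon>\<^sup>2 * a\<^sup>2 / 4"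
          by (simp add: power_mult_distrib power_divide)
        also have "\<dots> = x * (v * a\<^sup>2)"
          unfolding vx[symmetric] by simp
        also have "\<dots> \<le> m * (v * a\<^sup>2)"
          using mx v0 by (intro mult_right_mono) auto
        also have "\<dots> = n * m * T"
          using a by (simp add: v_def)
        finally have "400 * (\<epsilon> / 40 * a)\<^sup>2 \<le> n * m * T" .
        then have "(1 / 22) ^ m \<le> prob {\<omega> \<in> space M. \<bar>trunc_sum L n \<omega>\<bar> \<ge> \<epsilon> / 40 * a}"
          using trunc_sum_large_by_blocks[OF L _ _ m1 True, of "\<epsilon> / 40 * a"] T mean third \<epsilon> a
          unfolding T_def by simp
        \<comment> \<open>Rounding gives \<open>m \<le> 1 + x\<close>, hence
          \<open>4 * m \<le> 4 + \<epsilon>\<^sup>2 / v\<close>; the summand 4 is the origin of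
          \<open>exp (- 4)\<close>.\<close>
        moreover have "exp (- 4) * exp (- (\<epsilon>\<^sup>2 / v)) \<le> exp (- (4 * real m))"
          using mx v0 by (simp add: x_def flip: exp_add)
        moreover note exp_neg_four_le[of m]
        ultimately show ?thesis by linarith
      next
        case False
        have "v\<^sup>2 * a ^ 4 = n * (n * T\<^sup>2)"
          using a by (simp add: v_def power2_eq_square power4_eq_xxxx)
        also have "\<dots> \<le> n * (128 * L * m * trunc_third L)"
          using False by (intro mult_left_mono) auto
        also have "\<dots> = 128 * \<epsilon> * m * u * a ^ 4"
          using a by (simp add: L_def u_def power4_eq_xxxx power3_eq_cube)
        finally have v2: "v\<^sup>2 \<le> 128 * \<epsilon> * m * u"
          using a by simp
        \<comment> \<open>The block number \<open>m\<close> in \<open>v2\<close> grows like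
          \<open>1 / v\<close>. Multiplying by one more \<open>v\<close> makes it bounded, and this
          is why the cube of \<open>min 1 v\<close> appears.\<close>
        have "min 1 v ^ 3 \<le> 128 * \<epsilon> * (1 + \<epsilon>\<^sup>2 / 4) * u"
        proof (cases "v \<le> 1")
          case True
          have "v * m \<le> v * (1 + x)" using mx v0 by (intro mult_left_mono) auto
          also have "\<dots> = v + \<epsilon>\<^sup>2 / 4" using vx by (simp add: algebra_simps)
          finally have vm: "v * m \<le> 1 + \<epsilon>\<^sup>2 / 4" using True by linarith
          have "v ^ 3 = v * v\<^sup>2" by (simp add: power2_eq_square power3_eq_cube)
          also have "\<dots> \<le> v * (128 * \<epsilon> * m * u)" using v2 v0 by (intro mult_left_mono) auto
          also have "\<dots> = 128 * \<epsilon> * (v * m) * u" by simp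
          also have "\<dots> \<le> 128 * \<epsilon> * (1 + \<epsilon>\<^sup>2 / 4) * u"
            using vm \<epsilon> u0 by (intro mult_right_mono mult_left_mono) auto
          finally show ?thesis using True by (simp add: min_def)
        next
          case False
          have "x \<le> v * x" using False x0 by simp
          then have "m \<le> 1 + \<epsilon>\<^sup>2 / 4" using mx vx by linarith
          then have "128 * \<epsilon> * m * u \<le> 128 * \<epsilon> * (1 + \<epsilon>\<^sup>2 / 4) * u"
            using \<epsilon> u0 by (intro mult_right_mono mult_left_mono) auto
          with v2 show ?thesis
            using min_one_cube_le_square[of v] v0 by linarith
        qed
        then show ?thesis by simp
      qed
    qed
  qed
qed

text \<open>The two alternatives of \<open>trunc_sum_lower_or_third_large\<close> are merged into
  one sum. The point is that \<open>K\<close> depends neither on \<open>a\<close> nor on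
  \<open>n\<close>, so the bound may be summed against \<open>\<tau>\<close>.\<close>

lemma exponential_le_large_deviation:
  assumes \<epsilon>: "\<epsilon> > 0" and \<theta>: "\<theta> \<ge> 1"
  obtains K where "K > 0"
    "\<And>a n. a > 0 \<Longrightarrow> n \<ge> 8 \<Longrightarrow>
      exp_neg_quot (\<epsilon>\<^sup>2 * a\<^sup>2) (n * trunc_second_moment M (X 1) (\<epsilon> * a))
      \<le> K * (prob {\<omega> \<in> space M. \<bar>partial_sum X n \<omega>\<bar> \<ge> \<epsilon> / 40 * a} + n * tail (\<epsilon> * a)
        + (n * trunc_third (\<epsilon> * a) / a ^ 3) powr \<theta>)"
proof -
  obtain K where K: "K > 0" "\<And>v. v > 0 \<Longrightarrow> exp (- (\<epsilon>\<^sup>2 / v)) \<le> K * min 1 v powr (3 * \<theta>)"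
    using exp_neg_le_min_powr[of "\<epsilon>\<^sup>2" "3 * \<theta>"] \<epsilon> \<theta> by auto
  define c where "c = 128 * \<epsilon> * (1 + \<epsilon>\<^sup>2 / 4)"
  define K' where "K' = K * c powr \<theta> + exp 4"
  have c: "c > 0" using \<epsilon> by (auto simp: c_def intro!: mult_pos_pos add_pos_nonneg)
  have K': "K' > 0" "K * c powr \<theta> \<le> K'" "exp 4 \<le> K'"
    using K(1) by (auto simp: K'_def intro: add_nonneg_pos)
  show ?thesis
  proof (rule that[OF K'(1)])
    fix a :: real and n :: nat assume a: "a > 0" and n: "n \<ge> 8"
    let ?T = "trunc_second_moment M (X 1) (\<epsilon> * a)"
    let ?u = "n * trunc_third (\<epsilon> * a) / a ^ 3"
    let ?P = "prob {\<omega> \<in> space M. \<bar>partial_sum X n \<omega>\<bar> \<ge> \<epsilon> / 40 * a}"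
    have u: "?u \<ge> 0" using trunc_third_nonneg a by simp
    have nn: "?P \<ge> 0" "n * tail (\<epsilon> * a) \<ge> 0" "?u powr \<theta> \<ge> 0"
      using tail_nonneg by auto
    show "exp_neg_quot (\<epsilon>\<^sup>2 * a\<^sup>2) (n * ?T) \<le> K' * (?P + n * tail (\<epsilon> * a) + ?u powr \<theta>)"
    proof (cases "?T = 0")
      \<comment> \<open>By the convention in \<open>exp_neg_quot\<close> the left side is 0.\<close>
      case True
      have "0 \<le> K' * (?P + n * tail (\<epsilon> * a) + ?u powr \<theta>)"
        using nn K' tail_nonneg by (intro mult_nonneg_nonneg add_nonneg_nonneg) auto
      with True show ?thesis by (simp add: exp_neg_quot_def)
    next
      case False
      then have T: "?T > 0" using trunc_second_moment_nonneg[of "\<epsilon> * a"] by linarith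
      define v where "v = n * ?T / a\<^sup>2"
      have v: "v > 0" using T a n by (simp add: v_def)
      have "exp_neg_quot (\<epsilon>\<^sup>2 * a\<^sup>2) (n * ?T) = exp (- (\<epsilon>\<^sup>2 / v))"
        using T a n by (simp add: exp_neg_quot_def v_def)
      also have "\<dots> \<le> K' * (?P + n * tail (\<epsilon> * a) + ?u powr \<theta>)"
        using trunc_sum_lower_or_third_large[OF \<epsilon> a n T]
      proof
        assume "min 1 (n * ?T / a\<^sup>2) ^ 3 \<le> 128 * \<epsilon> * (1 + \<epsilon>\<^sup>2 / 4) * ?u"
        then have le: "min 1 v ^ 3 \<le> c * ?u" by (simp only: v_def c_def)
        have "exp (- (\<epsilon>\<^sup>2 / v)) \<le> K * min 1 v powr (3 * \<theta>)" by (rule K(2)[OF v])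
        also have "min 1 v powr (3 * \<theta>) = (min 1 v ^ 3) powr \<theta>"
          using v by (simp add: powr_powr flip: powr_numeral)
        also have "K * \<dots> \<le> K * (c * ?u) powr \<theta>"
          using le v \<theta> K(1) by (intro mult_left_mono powr_mono2) auto
        also have "\<dots> = K * c powr \<theta> * ?u powr \<theta>"
          using powr_mult[of c ?u \<theta>] by (simp only: mult.assoc)
        also have "\<dots> \<le> K' * ?u powr \<theta>"
          using K'(2) by (rule mult_right_mono) simp
        also have "\<dots> \<le> K' * (?P + n * tail (\<epsilon> * a) + ?u powr \<theta>)"
          using nn K'(1) by (intro mult_left_mono) auto
        finally show ?thesis .
      next
        assume "exp (- 4) * exp (- (\<epsilon>\<^sup>2 / (n * ?T / a\<^sup>2)))
          \<le> prob {\<omega> \<in> space M. \<bar>trunc_sum (\<epsilon> * a) n \<omega>\<bar> \<ge> \<epsilon> / 40 * a}"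
        also have "\<dots> \<le> ?P + n * tail (\<epsilon> * a)"
          by (rule prob_replace_trunc(2)) measurable
        finally have "exp (- (\<epsilon>\<^sup>2 / v)) \<le> exp 4 * (?P + n * tail (\<epsilon> * a))"
          by (simp add: v_def exp_minus field_simps)
        also have "\<dots> \<le> K' * (?P + n * tail (\<epsilon> * a) + ?u powr \<theta>)"
          using nn K'(1,3) by (intro mult_mono) auto
        finally show ?thesis .
      qed
      finally show ?thesis .
    qed
  qed
qed

end

section \<open>Medians and tails\<close>

context prob_space
begin

text \<open>The quantile of level \<open>1 / 2\<close>, as pseudoinverse of the distribution
  function, is a median.\<close>

lemma median_exists:
  assumes [measurable]: "random_variable borel Y"
  shows "\<exists>m. is_median M Y m"
proof -
  interpret D: cdf_distribution "distr M borel Y"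
    unfolding cdf_distribution_def by (rule real_distribution_distr) measurable
  have cdf: "cdf (distr M borel Y) x = prob {\<omega> \<in> space M. Y \<omega> \<le> x}" for x
    unfolding cdf_def by (subst measure_distr) (auto intro!: arg_cong[where f = prob])
  define m where "m = Inf {x. 1 / 2 \<le> cdf (distr M borel Y) x}"
  have iff: "1 / 2 \<le> cdf (distr M borel Y) x \<longleftrightarrow> m \<le> x" for x
    unfolding m_def by (rule D.pseudoinverse) auto
  have lt: "cdf (distr M borel Y) x \<le> 1 / 2" if "x < m" for x
    using iff[of x] that by linarith
  \<comment> \<open>The left limit of the distribution function at \<open>m\<close> is the
    probability of lying strictly below \<open>m\<close>; this gives the second half of the median
    property.\<close>
  have "(cdf (distr M borel Y) \<longlongrightarrow> measure (distr M borel Y) {..<m}) (at_left m)"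
    by (rule D.cdf_at_left)
  moreover have "eventually (\<lambda>x. cdf (distr M borel Y) x \<le> 1 / 2) (at_left m)"
    by (rule eventually_at_leftI[of "m - 1"], rule lt) auto
  ultimately have "measure (distr M borel Y) {..<m} \<le> 1 / 2"
    by (rule tendsto_upperbound) simp
  also have "measure (distr M borel Y) {..<m} = prob {\<omega> \<in> space M. \<not> Y \<omega> \<ge> m}"
    by (subst measure_distr) (auto intro!: arg_cong[where f = prob])
  also have "\<dots> = 1 - prob {\<omega> \<in> space M. Y \<omega> \<ge> m}"
    by (rule prob_neg) measurable
  finally have "is_median M Y m"
    using iff[of m] by (simp add: is_median_def cdf)
  then show ?thesis ..
qed

text \<open>Used with the truncated mean as \<open>c\<close>, to show by contraposition that median
  and mean are close, and with \<open>c = 0\<close>, to bound the medians themselves.\<close>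

lemma prob_deviation_ge_half:
  assumes "is_median M Y m" and t: "\<bar>m - c\<bar> \<ge> t" and [measurable]: "random_variable borel Y"
  shows "1 / 2 \<le> prob {\<omega> \<in> space M. \<bar>Y \<omega> - c\<bar> \<ge> t}"
proof (cases "m \<ge> c")
  case True
  have "1 / 2 \<le> prob {\<omega> \<in> space M. Y \<omega> \<ge> m}" using assms by (simp add: is_median_def)
  also have "\<dots> \<le> prob {\<omega> \<in> space M. \<bar>Y \<omega> - c\<bar> \<ge> t}"
    using t True by (intro finite_measure_mono) auto
  finally show ?thesis .
next
  case False
  have "1 / 2 \<le> prob {\<omega> \<in> space M. Y \<omega> \<le> m}" using assms by (simp add: is_median_def)
  also have "\<dots> \<le> prob {\<omega> \<in> space M. \<bar>Y \<omega> - c\<bar> \<ge> t}"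
    using t False by (intro finite_measure_mono) auto
  finally show ?thesis .
qed

end

context iid_reals
begin

section \<open>Tails, truncated third moments and the second moment method\<close>

lemma obtain_small_tail:
  assumes "c > 0"
  obtains r where "tail r \<le> c"
proof -
  have "(\<lambda>n. prob {\<omega> \<in> space M. \<bar>X 1 \<omega>\<bar> \<ge> real n}) \<longlonglongrightarrow>
      prob (\<Inter>n. {\<omega> \<in> space M. \<bar>X 1 \<omega>\<bar> \<ge> real n})"
    by (rule finite_Lim_measure_decseq) (auto simp: decseq_def)
  moreover have "(\<Inter>n. {\<omega> \<in> space M. \<bar>X 1 \<omega>\<bar> \<ge> real n}) = {}"
  proof (rule equals0I)
    fix \<omega> assume \<omega>: "\<omega> \<in> (\<Inter>n. {\<omega> \<in> space M. \<bar>X 1 \<omega>\<bar> \<ge> real n})"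
    obtain n where "\<bar>X 1 \<omega>\<bar> < real n" using reals_Archimedean2 by blast
    with INT_D[OF \<omega> UNIV_I, of n] show False by simp
  qed
  ultimately have "(\<lambda>n. tail (real n)) \<longlonglongrightarrow> 0"
    by (simp add: tail_def)
  then have "eventually (\<lambda>n. tail (real n) < c) sequentially"
    by (rule order_tendstoD(2)) (rule assms)
  then show ?thesis
    using that by (auto dest!: eventually_happens less_imp_le)
qed

text \<open>Raising the level only adds values with
  \<open>L \<le> \<bar>X 1 \<omega>\<bar> < K\<close>, whose cube is below \<open>K ^ 3\<close>.
  This supplies the increment hypothesis of \<open>powr_third_moment_summable\<close>, with
  \<open>F\<close> equal to one minus the tail.\<close>

lemma trunc_third_diff_le:
  assumes "0 \<le> L" "L \<le> K"
  shows "trunc_third K - trunc_third L \<le> K ^ 3 * (tail L - tail K)"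
    and "trunc_third L \<le> trunc_third K"
proof -
  let ?Y = "\<lambda>L \<omega>. \<bar>truncate_at L (X 1 \<omega>)\<bar> ^ 3"
  let ?A = "{\<omega> \<in> space M. \<bar>X 1 \<omega>\<bar> \<ge> L} - {\<omega> \<in> space M. \<bar>X 1 \<omega>\<bar> \<ge> K}"
  have int: "integrable M (?Y L)" "integrable M (?Y K)"
    using assms by (intro trunc_integrable(3); simp)+
  have "trunc_third K - trunc_third L = expectation (\<lambda>\<omega>. ?Y K \<omega> - ?Y L \<omega>)"
    unfolding trunc_third_def by (rule Bochner_Integration.integral_diff[OF int(2,1), symmetric])
  also have "\<dots> \<le> expectation (\<lambda>\<omega>. K ^ 3 * indicator ?A \<omega>)"
  proof (rule integral_mono)
    fix \<omega> assume \<omega>: "\<omega> \<in> space M"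
    have "\<bar>X 1 \<omega>\<bar> ^ 3 \<le> K ^ 3" if "\<bar>X 1 \<omega>\<bar> < K"
      using that by (intro power_mono) auto
    then show "?Y K \<omega> - ?Y L \<omega> \<le> K ^ 3 * indicator ?A \<omega>"
      using \<omega> assms by (auto simp: truncate_at_def indicator_def)
  qed (use int in \<open>auto simp: less_top[symmetric]\<close>)
  also have "\<dots> = K ^ 3 * prob ?A"
    by simp
  also have "prob ?A = tail L - tail K"
    unfolding tail_def using assms by (intro finite_measure_Diff) auto
  finally show "trunc_third K - trunc_third L \<le> K ^ 3 * (tail L - tail K)" .
  show "trunc_third L \<le> trunc_third K"
    unfolding trunc_third_def using int assms
    by (intro integral_mono) (auto simp: truncate_at_def)
qed

lemma prob_both_tails:
  assumes "j \<ge> 1" "k \<ge> 1" "j \<noteq> k"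
  shows "prob ({\<omega> \<in> space M. \<bar>X j \<omega>\<bar> \<ge> r} \<inter> {\<omega> \<in> space M. \<bar>X k \<omega>\<bar> \<ge> r}) = (tail r)\<^sup>2"
proof -
  have eq: "X i -` {x. \<bar>x\<bar> \<ge> r} \<inter> space M = {\<omega> \<in> space M. \<bar>X i \<omega>\<bar> \<ge> r}" for i
    by blast
  have "prob (\<Inter>i\<in>{j, k}. X i -` {x. \<bar>x\<bar> \<ge> r} \<inter> space M)
      = (\<Prod>i\<in>{j, k}. prob (X i -` {x. \<bar>x\<bar> \<ge> r} \<inter> space M))"
    using assms by (intro indep_varsD_finite[OF indep_vars_subset[OF indep]]) auto
  then show ?thesis
    unfolding eq using assms by (simp add: prob_tail_same power2_eq_square)
qed

text \<open>
  Second moment method without symmetrization: the events that a summand has modulus at least \<open>3 * b\<close>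
  while the remaining sum stays below \<open>2 * b\<close> force \<open>\<bar>S\<^sub>n\<bar> \<ge> b\<close>.
\<close>

lemma min_tail_le_prob:
  assumes tb: "tail b \<le> 1 / 4" and b: "b > 0"
  shows "min (n * tail (3 * b)) 1 \<le> 8 * prob {\<omega> \<in> space M. \<bar>partial_sum X n \<omega>\<bar> \<ge> b}"
    (is "_ \<le> 8 * ?P")
proof (cases "?P \<le> 1 / 4")
  case False
  then show ?thesis by (auto simp: min_le_iff_disj)
next
  case P: True
  define p where "p = tail (3 * b)"
  define A where "A = (\<lambda>k. {\<omega> \<in> space M. \<bar>X k \<omega>\<bar> \<ge> 3 * b})"
  define R where "R = (\<lambda>k \<omega>. \<Sum>i\<in>{1..n} - {k}. X i \<omega>)"
  define E where "E = (\<lambda>k. A k \<inter> {\<omega> \<in> space M. \<bar>R k \<omega>\<bar> < 2 * b})"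
  \<comment> \<open>This maximises
    \<open>2 * l * (n * p / 2) - l\<^sup>2 * (n * p * (1 + n * p))\<close>, the lower bound that the
    first and second moments will give.\<close>
  define l where "l = 1 / (2 * (1 + n * p))"
  have p0: "p \<ge> 0" by (simp add: p_def tail_nonneg)
  have np: "1 + n * p > 0" using p0 by (intro add_pos_nonneg) auto
  have l0: "l > 0" using np by (simp add: l_def)
  have Rrv[measurable]: "random_variable borel (R k)" for k
    unfolding R_def by (intro borel_measurable_sum rv) auto
  have Aev: "A k \<in> events" if "k \<ge> 1" for k
    unfolding A_def using rv[OF that] by measurable
  have Eev: "E k \<in> events" if "k \<ge> 1" for k
    unfolding E_def using Aev[OF that] by measurable
  have sumR: "partial_sum X n \<omega> = X k \<omega> + R k \<omega>" if "k \<in> {1..n}" for k \<omega>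
    unfolding partial_sum_def R_def using that by (intro sum.remove) auto
  have probE: "p / 2 \<le> prob (E k)" if k: "k \<in> {1..n}" for k
  proof -
    have k1: "k \<ge> 1" using k by simp
    note [measurable] = rv[OF k1]
    \<comment> \<open>If \<open>R k\<close> has modulus at least \<open>2 * b\<close>, then the sum
      or the single summand has modulus at least \<open>b\<close>; each of these has probability at
      most \<open>1 / 4\<close>.\<close>
    have "prob {\<omega> \<in> space M. \<bar>R k \<omega>\<bar> \<ge> 2 * b}
        \<le> prob ({\<omega> \<in> space M. \<bar>partial_sum X n \<omega>\<bar> \<ge> b} \<union> {\<omega> \<in> space M. \<bar>X k \<omega>\<bar> \<ge> b})"
      unfolding sumR[OF k] by (intro finite_measure_mono) auto
    also have "\<dots> \<le> ?P + prob {\<omega> \<in> space M. \<bar>X k \<omega>\<bar> \<ge> b}"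
      by (intro measure_subadditive) auto
    also have "\<dots> \<le> 1 / 4 + 1 / 4"
      using P tb prob_tail_same[OF k1] by (intro add_mono) auto
    finally have "1 / 2 \<le> 1 - prob {\<omega> \<in> space M. \<bar>R k \<omega>\<bar> \<ge> 2 * b}" by simp
    also have "\<dots> = prob {\<omega> \<in> space M. \<not> \<bar>R k \<omega>\<bar> \<ge> 2 * b}"
      by (rule prob_neg[symmetric]) measurable
    finally have half: "1 / 2 \<le> prob {\<omega> \<in> space M. \<bar>R k \<omega>\<bar> < 2 * b}"
      by (simp add: not_le)
    have "insert k ({1..n} - {k}) = {1..n}" using k by auto
    then have "indep_var borel (X k) borel (R k)"
      unfolding R_def using indep_vars_subset[OF indep, of "{1..n}"]
      by (intro indep_vars_sum) auto
    then have "prob ((\<lambda>x. (X k x, R k x)) -` ({x. \<bar>x\<bar> \<ge> 3 * b} \<times> {y. \<bar>y\<bar> < 2 * b}) \<inter> space M)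
        = prob (X k -` {x. \<bar>x\<bar> \<ge> 3 * b} \<inter> space M) * prob (R k -` {y. \<bar>y\<bar> < 2 * b} \<inter> space M)"
      by (rule indep_varD) measurable
    moreover have "(\<lambda>x. (X k x, R k x)) -` ({x. \<bar>x\<bar> \<ge> 3 * b} \<times> {y. \<bar>y\<bar> < 2 * b}) \<inter> space M = E k"
      by (auto simp: E_def A_def)
    moreover have "X k -` {x. \<bar>x\<bar> \<ge> 3 * b} \<inter> space M = {\<omega> \<in> space M. \<bar>X k \<omega>\<bar> \<ge> 3 * b}"
      "R k -` {y. \<bar>y\<bar> < 2 * b} \<inter> space M = {\<omega> \<in> space M. \<bar>R k \<omega>\<bar> < 2 * b}" by auto
    ultimately have "prob (E k) = p * prob {\<omega> \<in> space M. \<bar>R k \<omega>\<bar> < 2 * b}"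
      by (simp add: prob_tail_same[OF k1] p_def)
    with mult_left_mono[OF half p0] show ?thesis by simp
  qed
  \<comment> \<open>Two counting functions: \<open>f\<close> vanishes unless some \<open>E k\<close>
    occurs, while \<open>g\<close> dominates \<open>f\<close> and has a computable second moment,
    because the events \<open>A k\<close> are independent and the \<open>E k\<close> need not
    be.\<close>
  define f where "f = (\<lambda>\<omega>. \<Sum>k=1..n. indicator (E k) \<omega> :: real)"
  define g where "g = (\<lambda>\<omega>. \<Sum>k=1..n. indicator (A k) \<omega> :: real)"
  have g2: "(g \<omega>)\<^sup>2 = (\<Sum>j=1..n. \<Sum>k=1..n. indicator (A j \<inter> A k) \<omega>)" for \<omega>
    by (simp add: g_def power2_eq_square sum_product indicator_inter_arith)
  have ind_int: "integrable M (indicator B :: 'a \<Rightarrow> real)" if "B \<in> events" for B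
    using that by (simp add: less_top[symmetric])
  have ind_exp: "expectation (indicator B) = prob B" if "B \<in> events" for B
    using that by (simp add: sets.Int_space_eq2)
  have f_int: "integrable M f"
    unfolding f_def by (intro Bochner_Integration.integrable_sum ind_int Eev) auto
  have g_int: "integrable M (\<lambda>\<omega>. (g \<omega>)\<^sup>2)"
    unfolding g2 by (intro Bochner_Integration.integrable_sum ind_int sets.Int Aev) auto
  have "expectation f = (\<Sum>k=1..n. prob (E k))"
    unfolding f_def
    by (subst Bochner_Integration.integral_sum) (auto intro!: ind_int Eev simp: sets.Int_space_eq2 Eev)
  also have "\<dots> \<ge> (\<Sum>k=1..n. p / 2)"
    by (intro sum_mono probE)
  finally have Ef: "n * p / 2 \<le> expectation f" by simp
  have "expectation (\<lambda>\<omega>. (g \<omega>)\<^sup>2)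
      = (\<Sum>j=1..n. expectation (\<lambda>\<omega>. \<Sum>k=1..n. indicator (A j \<inter> A k) \<omega>))"
    unfolding g2
    by (intro Bochner_Integration.integral_sum Bochner_Integration.integrable_sum ind_int sets.Int Aev) auto
  also have "\<dots> = (\<Sum>j=1..n. \<Sum>k=1..n. expectation (indicator (A j \<inter> A k)))"
    by (intro sum.cong refl Bochner_Integration.integral_sum ind_int sets.Int Aev) auto
  also have "\<dots> = (\<Sum>j=1..n. \<Sum>k=1..n. prob (A j \<inter> A k))"
    by (intro sum.cong refl ind_exp sets.Int Aev) auto
  also have "\<dots> \<le> (\<Sum>j=1..n. \<Sum>k=1..n. (if j = k then p else 0) + p\<^sup>2)"
    using prob_both_tails[of _ _ "3 * b"] prob_tail_same[of _ "3 * b"]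
    by (intro sum_mono) (auto simp: A_def p_def)
  also have "\<dots> = n * p * (1 + n * p)"
    by (simp add: sum.distrib sum.delta power2_eq_square algebra_simps)
  finally have Eg: "expectation (\<lambda>\<omega>. (g \<omega>)\<^sup>2) \<le> n * p * (1 + n * p)" .
  have "2 * l * expectation f - l\<^sup>2 * expectation (\<lambda>\<omega>. (g \<omega>)\<^sup>2)
      = expectation (\<lambda>\<omega>. 2 * l * f \<omega> - l\<^sup>2 * (g \<omega>)\<^sup>2)"
    using f_int g_int by simp
  also have "\<dots> \<le> expectation (indicator {\<omega> \<in> space M. \<bar>partial_sum X n \<omega>\<bar> \<ge> b})"
  proof (rule integral_mono)
    fix \<omega> assume \<omega>: "\<omega> \<in> space M"
    \<comment> \<open>Where some \<open>E k\<close> occurs, use \<open>f \<le> g\<close> and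
      \<open>(1 - l * g)\<^sup>2 \<ge> 0\<close>; elsewhere \<open>f = 0\<close> makes the left side
      nonpositive.\<close>
    show "2 * l * f \<omega> - l\<^sup>2 * (g \<omega>)\<^sup>2 \<le> indicator {\<omega> \<in> space M. \<bar>partial_sum X n \<omega>\<bar> \<ge> b} \<omega>"
    proof (cases "\<exists>k\<in>{1..n}. \<omega> \<in> E k")
      case True
      then obtain k where k: "k \<in> {1..n}" "\<omega> \<in> E k" by blast
      then have "\<bar>partial_sum X n \<omega>\<bar> \<ge> b"
        using sumR[OF k(1), of \<omega>] by (auto simp: E_def A_def)
      then have "indicator {\<omega> \<in> space M. \<bar>partial_sum X n \<omega>\<bar> \<ge> b} \<omega> = (1 :: real)"
        using \<omega> by simp
      moreover have "f \<omega> \<le> g \<omega>"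
        unfolding f_def g_def by (intro sum_mono) (auto simp: indicator_def E_def)
      then have "2 * l * f \<omega> \<le> 2 * l * g \<omega>" using l0 by (intro mult_left_mono) auto
      moreover have "0 \<le> (1 - l * g \<omega>)\<^sup>2" by simp
      then have "2 * l * g \<omega> - l\<^sup>2 * (g \<omega>)\<^sup>2 \<le> 1"
        by (simp add: power2_eq_square algebra_simps)
      ultimately show ?thesis by linarith
    next
      case False
      then have "f \<omega> = 0" unfolding f_def by (intro sum.neutral) auto
      then have "2 * l * f \<omega> = 0" by simp
      moreover have "l\<^sup>2 * (g \<omega>)\<^sup>2 \<ge> 0" by simp
      moreover have "indicator {\<omega> \<in> space M. \<bar>partial_sum X n \<omega>\<bar> \<ge> b} \<omega> \<ge> (0 :: real)" by simp
      ultimately show ?thesis by linarith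
    qed
  qed (use f_int g_int in \<open>auto intro!: ind_int\<close>)
  also have "\<dots> = ?P" by simp
  finally have main: "2 * l * expectation f - l\<^sup>2 * expectation (\<lambda>\<omega>. (g \<omega>)\<^sup>2) \<le> ?P" .
  have "2 * l * (n * p / 2) \<le> 2 * l * expectation f"
    using Ef l0 by (intro mult_left_mono) auto
  moreover have "l\<^sup>2 * expectation (\<lambda>\<omega>. (g \<omega>)\<^sup>2) \<le> l\<^sup>2 * (n * p * (1 + n * p))"
    using Eg by (intro mult_left_mono) auto
  moreover have "l\<^sup>2 * (n * p * (1 + n * p)) = l * (n * p / 2)"
  proof -
    have "l\<^sup>2 * (n * p * (1 + n * p)) = l * (n * p) * (l * (1 + n * p))"
      by (simp add: power2_eq_square)
    also have "l * (1 + n * p) = 1 / 2" using np by (simp add: l_def)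
    finally show ?thesis by simp
  qed
  ultimately have "l * (n * p / 2) \<le> ?P" using main by linarith
  moreover have "min (n * p) 1 \<le> 8 * (l * (n * p / 2))"
  proof -
    have "min x 1 * (1 + x) \<le> 2 * x" if "x \<ge> 0" for x :: real
    proof (cases "x \<le> 1")
      case True
      then show ?thesis using mult_left_mono[OF True that] by (simp add: algebra_simps)
    qed simp
    from this[of "n * p"] have "min (n * p) 1 * (1 + n * p) \<le> 2 * (n * p)"
      using p0 by simp
    then show ?thesis using np by (simp add: l_def field_simps)
  qed
  ultimately show ?thesis by (simp add: p_def)
qed

end

section \<open>The series criterion\<close>

lemma growth_if_liminf_positive:
  fixes a W :: "nat \<Rightarrow> real"
  assumes a: "\<And>n. n \<ge> 1 \<Longrightarrow> a n > 0"
    and lim: "liminf (\<lambda>n. INF k\<in>{n..}. ereal (a k ^ 3 / (real k * a n ^ 3) * W n)) > 0"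
  shows "\<exists>c>0. \<exists>n0. \<forall>j\<ge>n0. \<forall>k\<ge>j. c * (real k * a j ^ 3) \<le> a k ^ 3 * W j"
proof -
  obtain c where c: "0 < ereal c"
    "ereal c < liminf (\<lambda>n. INF k\<in>{n..}. ereal (a k ^ 3 / (real k * a n ^ 3) * W n))"
    using ereal_dense2[OF lim] by blast
  obtain n0 where n0: "\<And>n. n \<ge> n0 \<Longrightarrow>
      ereal c < (INF k\<in>{n..}. ereal (a k ^ 3 / (real k * a n ^ 3) * W n))"
    using less_LiminfD[OF c(2)] unfolding eventually_sequentially by blast
  have "c * (real k * a j ^ 3) \<le> a k ^ 3 * W j" if "j \<ge> max n0 1" "k \<ge> j" for j k
  proof -
    have "ereal c < ereal (a k ^ 3 / (real k * a j ^ 3) * W j)"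
      using that by (intro less_le_trans[OF n0 INF_lower]) auto
    then have "c \<le> a k ^ 3 / (real k * a j ^ 3) * W j" by simp
    moreover have "real k * a j ^ 3 > 0" using a[of j] that by simp
    ultimately show ?thesis by (simp add: field_simps)
  qed
  then have "\<forall>j\<ge>max n0 1. \<forall>k\<ge>j. c * (real k * a j ^ 3) \<le> a k ^ 3 * W j" by blast
  moreover have "c > 0" using c(1) by simp
  ultimately show ?thesis by blast
qed

context iid_reals
begin

text \<open>Instance of \<open>powr_third_moment_summable\<close> with \<open>F\<close> one minus
  the tail at \<open>\<delta> * a n\<close>; the constant \<open>D = \<delta> ^ 3\<close> is the
  cube of the ratio between truncation level and \<open>a n\<close>.\<close>

lemma third_moment_series_summable:
  fixes \<tau> a :: "nat \<Rightarrow> real" and \<theta> C :: real and N :: nat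
  assumes \<tau>: "\<And>n. n \<ge> 1 \<Longrightarrow> \<tau> n \<ge> 0" and a: "\<And>n. n \<ge> 1 \<Longrightarrow> a n > 0" and mono_a: "mono_on {1..} a"
    and \<theta>: "\<theta> \<ge> 1" and C: "C > 0"
    and regular: "\<And>n. n \<ge> N \<Longrightarrow>
           (\<lambda>k. real k powr \<theta> * \<tau> k / a k powr (3 * \<theta>)) summable_on {n..} \<and>
           a n powr (3 * \<theta>) / real n powr (\<theta> - 1) *
             (\<Sum>\<^sub>\<infinity>k\<in>{n..}. real k powr \<theta> * \<tau> k / a k powr (3 * \<theta>))
           \<le> C * (\<Sum>k=1..n-1. real k * \<tau> k)"
    and growth: "\<theta> > 1 \<Longrightarrow> \<exists>c>0. \<exists>n0. \<forall>j\<ge>n0. \<forall>k\<ge>j.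
           c * (real k * a j ^ 3) \<le> a k ^ 3 * (\<Sum>i=1..j-1. real i * \<tau> i)"
    and \<delta>: "\<delta> > 0"
    and tails: "(\<lambda>n. real n * \<tau> n * tail (\<delta> * a n)) summable_on {1..}"
  shows "(\<lambda>n. \<tau> n * (real n * trunc_third (\<delta> * a n) / a n ^ 3) powr \<theta>) summable_on {1..}"
proof -
  \<comment> \<open>The value \<open>a 0\<close> is unconstrained, so indices are shifted away from \<open>0\<close>.\<close>
  define B where "B = (\<lambda>n. trunc_third (\<delta> * a (max 1 n)))"
  define F where "F = (\<lambda>n. 1 - tail (\<delta> * a (max 1 n)))"
  have am: "\<delta> * a (max 1 m) \<le> \<delta> * a (max 1 n)" if "m \<le> n" for m n
    using mono_onD[OF mono_a, of "max 1 m" "max 1 n"] that \<delta> by (intro mult_left_mono) auto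
  have a0: "\<delta> * a (max 1 n) \<ge> 0" for n
    using a[of "max 1 n"] \<delta> by simp
  have "(\<lambda>n. \<tau> n * (real n * B n / a n ^ 3) powr \<theta>) summable_on {1..}"
  proof (rule powr_third_moment_summable[where F = F and N = N and C = C and D = "\<delta> ^ 3"])
    show "0 \<le> B n" for n by (simp add: B_def trunc_third_nonneg)
    show "mono B" unfolding B_def by (intro monoI trunc_third_diff_le(2) a0 am)
    show "mono F" unfolding F_def by (intro monoI diff_left_mono tail_antimono am)
    show "F n \<le> 1" for n by (simp add: F_def tail_nonneg)
    show "B (Suc n) - B n \<le> \<delta> ^ 3 * a (Suc n) ^ 3 * (F (Suc n) - F n)" if "n \<ge> 1" for n
      using trunc_third_diff_le(1)[OF a0 am[OF le_SucI[OF order_refl]], of n]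
      by (simp add: B_def F_def power_mult_distrib)
    show "(\<lambda>n. real n * \<tau> n * (1 - F n)) summable_on {1..}"
      by (rule summable_on_cong[THEN iffD1, OF _ tails]) (simp add: F_def max_def)
  qed (use \<tau> a \<theta> C \<delta> regular growth in auto)
  then show ?thesis
    by (rule summable_on_cong[THEN iffD1, rotated]) (simp add: B_def max_def)
qed

text \<open>One third of \<open>\<epsilon>\<close> each goes to the median, to the distance between
  median and truncated mean, and to the deviation from that mean.\<close>

lemma large_deviation_series_if_conditions:
  fixes \<tau> a :: "nat \<Rightarrow> real"
  assumes \<tau>: "\<And>n. n \<ge> 1 \<Longrightarrow> \<tau> n \<ge> 0" and a: "\<And>n. n \<ge> 1 \<Longrightarrow> a n > 0" and \<theta>: "\<theta> \<ge> 1"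
    and third: "\<And>\<delta>. \<delta> > 0 \<Longrightarrow> (\<lambda>n. real n * \<tau> n * tail (\<delta> * a n)) summable_on {1..} \<Longrightarrow>
      (\<lambda>n. \<tau> n * (real n * trunc_third (\<delta> * a n) / a n ^ 3) powr \<theta>) summable_on {1..}"
    and med: "median_condition M X \<tau> a" and tails: "tail_condition M X \<tau> a"
    and expo: "exponential_condition M X \<tau> a"
  shows "large_deviation_series_converges M X \<tau> a"
  unfolding large_deviation_series_converges_def
proof (intro allI impI)
  fix \<epsilon> :: real assume "\<epsilon> > 0"
  define t where "t = \<epsilon> / 3"
  define \<delta> where "\<delta> = t / (4 * \<theta>)"
  have t: "t > 0" and \<delta>: "\<delta> > 0" using \<open>\<epsilon> > 0\<close> \<theta> by (auto simp: t_def \<delta>_def)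
  obtain \<mu> where \<mu>: "\<And>n. n \<ge> 1 \<Longrightarrow> is_median M (partial_sum X n) (\<mu> n)"
    "\<And>e. e > 0 \<Longrightarrow> \<tau> summable_on {n. n \<ge> 1 \<and> \<bar>\<mu> n\<bar> > e * a n}"
    using med unfolding median_condition_def by blast
  define K where "K = 2 * exp (288 * \<theta> ^ 3)"
  define K' where "K' = (1 / t ^ 3) powr \<theta>"
  define e where "e = (\<lambda>n. exp_neg_quot (\<delta>\<^sup>2 * (a n)\<^sup>2) (real n * trunc_second_moment M (X 1) (\<delta> * a n)))"
  define u where "u = (\<lambda>n. (real n * trunc_third (\<delta> * a n) / a n ^ 3) powr \<theta>)"
  define Q where "Q = (\<lambda>n. K * (e n + K' * u n) + n * tail (\<delta> * a n))"
  define J where "J = (\<lambda>n. if \<bar>\<mu> n\<bar> > t * a n then 1 else 0 :: real)"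
  have T: "(\<lambda>n. real n * \<tau> n * tail (\<delta> * a n)) summable_on {1..}"
    using tails \<delta> unfolding tail_condition_def tail_def by blast
  have U: "(\<lambda>n. \<tau> n * u n) summable_on {1..}"
    unfolding u_def by (rule third[OF \<delta> T])
  have E: "(\<lambda>n. \<tau> n * e n) summable_on {1..}"
    using expo \<delta> unfolding exponential_condition_def e_def by blast
  have "(\<lambda>n. \<tau> n * J n) summable_on {1..}"
    by (rule summable_on_cong_neutral[THEN iffD1, OF _ _ _ \<mu>(2)[OF t]]) (auto simp: J_def)
  then have "(\<lambda>n. (2 * K) * (\<tau> n * e n) + (2 * K * K') * (\<tau> n * u n)
      + 2 * (real n * \<tau> n * tail (\<delta> * a n)) + \<tau> n * J n) summable_on {1..}"
    by (intro summable_on_add summable_on_cmult_right E U T)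
  then have summ: "(\<lambda>n. \<tau> n * (2 * Q n + J n)) summable_on {1..}"
    by (rule summable_on_cong[THEN iffD1, rotated]) (simp add: Q_def algebra_simps)
  show "(\<lambda>n. \<tau> n * prob {\<omega> \<in> space M. \<bar>partial_sum X n \<omega>\<bar> \<ge> \<epsilon> * a n}) summable_on {1..}"
  proof (rule summable_on_comparison_test[OF summ])
    fix n :: nat assume "n \<in> {1..}"
    then have n: "n \<ge> 1" by simp
    let ?c = "n * trunc_mean (\<delta> * a n)"
    let ?D = "prob {\<omega> \<in> space M. \<bar>partial_sum X n \<omega> - ?c\<bar> \<ge> t * a n}"
    have ta: "t * a n > 0" using t a[OF n] by simp
    have "?D \<le> prob {\<omega> \<in> space M. \<bar>trunc_sum (\<delta> * a n) n \<omega> - ?c\<bar> \<ge> t * a n} + n * tail (\<delta> * a n)"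
      by (rule prob_replace_trunc(1)) measurable
    also have "\<dots> \<le> Q n"
      using trunc_sum_upper[OF \<theta> t a[OF n] \<delta>_def, of n]
      by (simp add: Q_def K_def K'_def e_def u_def)
    finally have DQ: "?D \<le> Q n" .
    have D0: "?D \<ge> 0" by simp
    have "prob {\<omega> \<in> space M. \<bar>partial_sum X n \<omega>\<bar> \<ge> \<epsilon> * a n} \<le> 2 * Q n + J n"
    \<comment> \<open>In the first case the bound is trivial, being at least 1: either
      \<open>J n = 1\<close>, or \<open>2 * Q n \<ge> 1\<close>, which explains the factor 2.
      Otherwise \<open>prob_deviation_ge_half\<close> places the mean within \<open>t * a n\<close>
      of a median that is itself within \<open>t * a n\<close> of 0.\<close>
    proof (cases "\<bar>\<mu> n\<bar> > t * a n \<or> ?D \<ge> 1 / 2")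
      case True
      then have "1 \<le> 2 * Q n + J n"
      proof
        assume "\<bar>\<mu> n\<bar> > t * a n"
        then have "J n = 1" by (simp add: J_def)
        then show ?thesis using DQ D0 by linarith
      next
        assume "?D \<ge> 1 / 2"
        moreover have "J n \<ge> 0" by (simp add: J_def)
        ultimately show ?thesis using DQ by linarith
      qed
      then show ?thesis using prob_le_1 order_trans by blast
    next
      case False
      then have "\<bar>\<mu> n - ?c\<bar> < t * a n"
        using prob_deviation_ge_half[OF \<mu>(1)[OF n], where c = ?c and t = "t * a n"]
        by (meson not_le partial_sum_rv)
      then have c: "\<bar>?c\<bar> < 2 * (t * a n)" using False by linarith
      have "prob {\<omega> \<in> space M. \<bar>partial_sum X n \<omega>\<bar> \<ge> \<epsilon> * a n} \<le> ?D"
      proof (rule finite_measure_mono)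
        have "\<epsilon> * a n = 3 * (t * a n)" by (simp add: t_def)
        then have "\<bar>partial_sum X n \<omega> - ?c\<bar> \<ge> t * a n"
          if "\<bar>partial_sum X n \<omega>\<bar> \<ge> \<epsilon> * a n" for \<omega>
          using that c by linarith
        then show "{\<omega> \<in> space M. \<bar>partial_sum X n \<omega>\<bar> \<ge> \<epsilon> * a n}
            \<subseteq> {\<omega> \<in> space M. \<bar>partial_sum X n \<omega> - ?c\<bar> \<ge> t * a n}" by blast
      qed measurable
      moreover have "J n \<ge> 0" by (simp add: J_def)
      ultimately show ?thesis using DQ D0 by linarith
    qed
    then show "\<tau> n * prob {\<omega> \<in> space M. \<bar>partial_sum X n \<omega>\<bar> \<ge> \<epsilon> * a n} \<le> \<tau> n * (2 * Q n + J n)"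
      using \<tau>[OF n] by (rule mult_left_mono)
    show "0 \<le> \<tau> n * prob {\<omega> \<in> space M. \<bar>partial_sum X n \<omega>\<bar> \<ge> \<epsilon> * a n}"
      using \<tau>[OF n] by simp
  qed
qed

section \<open>Necessity of the three conditions\<close>

lemma median_condition_if_large_deviation_series:
  assumes \<tau>: "\<And>n. n \<ge> 1 \<Longrightarrow> \<tau> n \<ge> 0" and ld: "large_deviation_series_converges M X \<tau> a"
  shows "median_condition M X \<tau> a"
proof -
  obtain \<mu> where \<mu>: "\<And>n. is_median M (partial_sum X n) (\<mu> n)"
    using median_exists[OF partial_sum_rv] by metis
  have "\<tau> summable_on {n. n \<ge> 1 \<and> \<bar>\<mu> n\<bar> > \<epsilon> * a n}" if "\<epsilon> > 0" for \<epsilon>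
  proof -
    let ?P = "\<lambda>n. prob {\<omega> \<in> space M. \<bar>partial_sum X n \<omega>\<bar> \<ge> \<epsilon> * a n}"
    have "(\<lambda>n. \<tau> n * ?P n) summable_on {1..}"
      using ld that unfolding large_deviation_series_converges_def by blast
    then have "(\<lambda>n. 2 * (\<tau> n * ?P n)) summable_on {n. n \<ge> 1 \<and> \<bar>\<mu> n\<bar> > \<epsilon> * a n}"
      by (intro summable_on_cmult_right) (rule summable_on_subset, auto)
    then show ?thesis
    proof (rule summable_on_comparison_test)
      fix n assume n: "n \<in> {n. n \<ge> 1 \<and> \<bar>\<mu> n\<bar> > \<epsilon> * a n}"
      \<comment> \<open>On the index set in question the probability is at least
        \<open>1 / 2\<close>, so the convergent series dominates half the sum of
        \<open>\<tau>\<close>; any choice of medians works.\<close>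
      then have "1 / 2 \<le> ?P n"
        using prob_deviation_ge_half[OF \<mu>[of n], where c = 0 and t = "\<epsilon> * a n"] by simp
      then show "\<tau> n \<le> 2 * (\<tau> n * ?P n)"
        using mult_left_mono[of "1 / 2" "?P n" "\<tau> n"] \<tau> n by simp
    qed (use \<tau> in auto)
  qed
  with \<mu> show ?thesis unfolding median_condition_def by blast
qed

text \<open>Condition A is applied to the tail at \<open>\<epsilon> * a n\<close>, nonincreasing
  because \<open>a\<close> is nondecreasing. The level \<open>b n\<close> is a third of
  \<open>\<epsilon> * a n\<close>, since \<open>min_tail_le_prob\<close> controls the tail at
  \<open>3 * b\<close>.\<close>

lemma tail_condition_if_large_deviation_series:
  assumes cond_A: "condition_A \<tau>" and ld: "large_deviation_series_converges M X \<tau> a"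
    and a: "\<And>n. n \<ge> 1 \<Longrightarrow> a n > 0" and mono_a: "mono_on {1..} a"
    and lim_a: "filterlim a at_top sequentially"
  shows "tail_condition M X \<tau> a"
  unfolding tail_condition_def
proof (intro allI impI)
  fix \<epsilon> :: real assume \<epsilon>: "\<epsilon> > 0"
  define b where "b = (\<lambda>n. \<epsilon> / 3 * a n)"
  define c where "c = (\<lambda>n. tail (\<epsilon> * a n))"
  let ?P = "\<lambda>n. prob {\<omega> \<in> space M. \<bar>partial_sum X n \<omega>\<bar> \<ge> b n}"
  have \<tau>: "\<tau> n \<ge> 0" if "n \<ge> 1" for n
    using cond_A that by (simp add: condition_A_def)
  obtain r where r: "tail r \<le> 1 / 4"
    using obtain_small_tail[of "1 / 4"] by auto
  \<comment> \<open>Divergence of \<open>a\<close> makes \<open>b n\<close> exceed \<open>r\<close>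
    eventually, as the hypothesis \<open>tail b \<le> 1 / 4\<close> of
    \<open>min_tail_le_prob\<close> demands.\<close>
  have "eventually (\<lambda>n. r / (\<epsilon> / 3) \<le> a n) sequentially"
    using lim_a by (simp add: filterlim_at_top)
  then obtain n0 where n0: "\<And>n. n \<ge> n0 \<Longrightarrow> r / (\<epsilon> / 3) \<le> a n"
    by (auto simp: eventually_sequentially)
  have "(\<lambda>n. \<tau> n * ?P n) summable_on {1..}"
    unfolding b_def
    by (rule ld[unfolded large_deviation_series_converges_def, rule_format]) (use \<epsilon> in simp)
  then have "(\<lambda>n. 8 * (\<tau> n * ?P n)) summable_on {1..}"
    by (rule summable_on_cmult_right)
  then have "(\<lambda>n. \<tau> n * min (real n * c n) 1) summable_on {1..}"
  proof (rule summable_on_atLeast1_comparison)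
    fix n assume n: "n \<ge> n0" "n \<ge> 1"
    have "r \<le> b n" using n0[OF n(1)] \<epsilon> by (simp add: b_def field_simps)
    then have "tail (b n) \<le> 1 / 4" using tail_antimono r order_trans by blast
    then have "min (n * tail (3 * b n)) 1 \<le> 8 * ?P n"
      using a[OF n(2)] \<epsilon> by (intro min_tail_le_prob) (auto simp: b_def)
    then have "min (real n * c n) 1 \<le> 8 * ?P n" by (simp add: b_def c_def)
    then show "\<tau> n * min (real n * c n) 1 \<le> 8 * (\<tau> n * ?P n)"
      using mult_left_mono[OF _ \<tau>[OF n(2)]] by fastforce
  qed (use \<tau> tail_nonneg in \<open>auto simp: c_def\<close>)
  moreover have "antimono_on {1..} c"
    using mono_a \<epsilon> unfolding c_def monotone_on_def by (auto intro!: tail_antimono mult_left_mono)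
  moreover have "\<forall>n\<ge>1. 0 \<le> c n" by (simp add: c_def tail_nonneg)
  ultimately have "(\<lambda>n. \<tau> n * (real n * c n)) summable_on {1..}"
    using cond_A unfolding condition_A_def by blast
  then show "(\<lambda>n. real n * \<tau> n * prob {\<omega> \<in> space M. \<bar>X 1 \<omega>\<bar> \<ge> \<epsilon> * a n}) summable_on {1..}"
    by (simp add: c_def tail_def mult_ac)
qed

text \<open>The tail condition is a hypothesis here because it feeds both the truncation error and,
  through \<open>third\<close>, the series of \<open>u\<close>; it therefore has to be derived
  beforehand.\<close>

lemma exponential_condition_if_large_deviation_series:
  assumes \<tau>: "\<And>n. n \<ge> 1 \<Longrightarrow> \<tau> n \<ge> 0" and a: "\<And>n. n \<ge> 1 \<Longrightarrow> a n > 0" and \<theta>: "\<theta> \<ge> 1"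
    and third: "\<And>\<delta>. \<delta> > 0 \<Longrightarrow> (\<lambda>n. real n * \<tau> n * tail (\<delta> * a n)) summable_on {1..} \<Longrightarrow>
      (\<lambda>n. \<tau> n * (real n * trunc_third (\<delta> * a n) / a n ^ 3) powr \<theta>) summable_on {1..}"
    and ld: "large_deviation_series_converges M X \<tau> a" and tails: "tail_condition M X \<tau> a"
  shows "exponential_condition M X \<tau> a"
  unfolding exponential_condition_def
proof (intro allI impI)
  fix \<epsilon> :: real assume \<epsilon>: "\<epsilon> > 0"
  define u where "u = (\<lambda>n. (real n * trunc_third (\<epsilon> * a n) / a n ^ 3) powr \<theta>)"
  let ?P = "\<lambda>n. prob {\<omega> \<in> space M. \<bar>partial_sum X n \<omega>\<bar> \<ge> \<epsilon> / 40 * a n}"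
  obtain K where "K > 0" and K: "\<And>a n. a > 0 \<Longrightarrow> n \<ge> 8 \<Longrightarrow>
      exp_neg_quot (\<epsilon>\<^sup>2 * a\<^sup>2) (n * trunc_second_moment M (X 1) (\<epsilon> * a))
      \<le> K * (prob {\<omega> \<in> space M. \<bar>partial_sum X n \<omega>\<bar> \<ge> \<epsilon> / 40 * a} + n * tail (\<epsilon> * a)
        + (n * trunc_third (\<epsilon> * a) / a ^ 3) powr \<theta>)"
    by (rule exponential_le_large_deviation[OF \<epsilon> \<theta>]) (rule that, assumption+)
  have T: "(\<lambda>n. real n * \<tau> n * tail (\<epsilon> * a n)) summable_on {1..}"
    using tails \<epsilon> unfolding tail_condition_def tail_def by blast
  have U: "(\<lambda>n. \<tau> n * u n) summable_on {1..}"
    unfolding u_def by (rule third[OF \<epsilon> T])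
  have P: "(\<lambda>n. \<tau> n * ?P n) summable_on {1..}"
    by (rule ld[unfolded large_deviation_series_converges_def, rule_format]) (use \<epsilon> in simp)
  have "(\<lambda>n. K * (\<tau> n * ?P n) + K * (real n * \<tau> n * tail (\<epsilon> * a n)) + K * (\<tau> n * u n))
      summable_on {1..}"
    by (intro summable_on_add summable_on_cmult_right P T U)
  then show "(\<lambda>n. \<tau> n * exp_neg_quot (\<epsilon>\<^sup>2 * (a n)\<^sup>2)
      (real n * trunc_second_moment M (X 1) (\<epsilon> * a n))) summable_on {1..}"
  proof (rule summable_on_atLeast1_comparison)
    fix n :: nat assume n: "n \<ge> 8" "n \<ge> 1"
    show "\<tau> n * exp_neg_quot (\<epsilon>\<^sup>2 * (a n)\<^sup>2) (real n * trunc_second_moment M (X 1) (\<epsilon> * a n))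
        \<le> K * (\<tau> n * ?P n) + K * (real n * \<tau> n * tail (\<epsilon> * a n)) + K * (\<tau> n * u n)"
      using mult_left_mono[OF K[OF a[OF n(2)] n(1)] \<tau>[OF n(2)]]
      by (simp add: u_def algebra_simps)
  qed (use \<tau> in \<open>auto simp: exp_neg_quot_def\<close>)
qed

end

theorem theorem1:
  fixes M :: "'a measure"
    and X :: "nat \<Rightarrow> 'a \<Rightarrow> real"
    and \<tau> a :: "nat \<Rightarrow> real"
    and \<theta> C :: real
    and N :: nat
  assumes "prob_space M"
    and "iid_sequence M X"
    and "\<forall>n\<ge>1. \<tau> n \<ge> 0"
    and "\<forall>n\<ge>1. a n > 0"
    and "mono_on {1..} a"
    and "filterlim a at_top sequentially"
    and "\<theta> \<ge> 1" and "C > 0" and "N \<ge> 2"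
    and "\<forall>n\<ge>N.
           (\<lambda>k. real k powr \<theta> * \<tau> k / a k powr (3 * \<theta>)) summable_on {n..} \<and>
           a n powr (3 * \<theta>) / real n powr (\<theta> - 1) *
             (\<Sum>\<^sub>\<infinity>k\<in>{n..}. real k powr \<theta> * \<tau> k / a k powr (3 * \<theta>))
           \<le> C * (\<Sum>k=1..n-1. real k * \<tau> k)"
    and "\<theta> > 1 \<Longrightarrow>
           liminf (\<lambda>n. INF k\<in>{n..}.
             ereal (a k ^ 3 / (real k * a n ^ 3) * (\<Sum>j=1..n-1. real j * \<tau> j))) > 0"
  shows "(median_condition M X \<tau> a \<and> tail_condition M X \<tau> a \<and> exponential_condition M X \<tau> a
            \<longrightarrow> large_deviation_series_converges M X \<tau> a) \<and>
         (condition_A \<tau> \<and> large_deviation_series_converges M X \<tau> a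
            \<longrightarrow> median_condition M X \<tau> a \<and> tail_condition M X \<tau> a \<and> exponential_condition M X \<tau> a)"
proof -
  interpret iid_reals M X
    using assms(1,2) by (simp add: iid_reals_def iid_reals_axioms_def)
  have \<tau>: "\<And>n. n \<ge> 1 \<Longrightarrow> \<tau> n \<ge> 0" and a: "\<And>n. n \<ge> 1 \<Longrightarrow> a n > 0"
    using assms(3,4) by auto
  have growth: "\<exists>c>0. \<exists>n0. \<forall>j\<ge>n0. \<forall>k\<ge>j.
      c * (real k * a j ^ 3) \<le> a k ^ 3 * (\<Sum>i=1..j-1. real i * \<tau> i)" if "\<theta> > 1"
    by (rule growth_if_liminf_positive[OF a assms(11)[OF that]])
  have third: "(\<lambda>n. \<tau> n * (real n * trunc_third (\<delta> * a n) / a n ^ 3) powr \<theta>) summable_on {1..}"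
    if "\<delta> > 0" "(\<lambda>n. real n * \<tau> n * tail (\<delta> * a n)) summable_on {1..}" for \<delta>
    by (rule third_moment_series_summable[OF \<tau> a assms(5,7,8) _ growth that])
      (use assms(10) in auto)
  show ?thesis
  proof (intro conjI impI; elim conjE)
    assume "median_condition M X \<tau> a" "tail_condition M X \<tau> a" "exponential_condition M X \<tau> a"
    from large_deviation_series_if_conditions[OF \<tau> a assms(7) third this]
    show "large_deviation_series_converges M X \<tau> a" .
  next
    assume A: "condition_A \<tau>" and ld: "large_deviation_series_converges M X \<tau> a"
    show "median_condition M X \<tau> a"
      by (rule median_condition_if_large_deviation_series[OF \<tau> ld])
    show tails: "tail_condition M X \<tau> a"
      by (rule tail_condition_if_large_deviation_series[OF A ld a assms(5,6)])
    show "exponential_condition M X \<tau> a"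
      by (rule exponential_condition_if_large_deviation_series[OF \<tau> a assms(7) third ld tails])
  qed
qed

end
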